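(* (Converse construction for $\mathrm{CD}_{2\sim}$.) Let $G$ be a finite innately transitive group on $\Omega$ with a non-abelian plinth $M$, let $T_1,\ldots,T_k$ be the simple direct factors of $M$, $\mathcal T=\{T_1,\dots,T_k\}$, and let $\omega\in\Omega$. Assume that $M_\omega=\sigma_1(M_\omega)\times\cdots\times\sigma_k(M_\omega)$. Suppose that $A_1,B_1$ are subgroups of $T_1$ such that (i) $A_1,B_1$ are isomorphic proper subgroups of $T_1$; (ii) $A_1$ and $B_1$ are conjugate under $G_\omega$; (iii) $A_1B_1=T_1$ and $A_1\cap B_1=\sigma_1(M_\omega)$; (iv) $N_{G_\omega}(T_1)=\{g\in G_\omega : \{A_1,B_1\}^g=\{A_1,B_1\}\}$. Suppose further that $\Gamma=(V,\mathcal T,\varepsilon)$ is a generalised graph, that $G_\omega$ acts on $V\cup\mathcal T$ inducing a vertex-transitive and edge-transitive group of automorphisms of $\Gamma$, where the action of $G_\omega$ on $\mathcal T$ is by conjugation, and that, with $\varepsilon(T_1)=\{v_1,v_2\}$, for every $g\in N_{G_\omega}(T_1)$ we have $$(A_1,B_1)^g=(A_1,B_1)\quad\text{if and only if}\quad (v_1,v_2)^g=(v_1,v_2).$$ Then there exists a $G$-invariant Cartesian decomposition $\mathcal E\in\mathrm{CD}_{2\sim}(G)$ of $\Omega$ such that $\Gamma\cong\Gamma(G,\mathcal E)$ and $\mathcal F_1(\mathcal E,M,\omega)=\{A_1,B_1\}$.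
   Context: All groups act on the right. A permutation group $G\le \mathrm{Sym}\,\Omega$ is *innately transitive* if it has a transitive minimal normal subgroup, called a *plinth*. A *Cartesian decomposition* of $\Omega$ is a set $\{\Gamma_1,\dots,\Gamma_\ell\}$ of proper partitions of $\Omega$ with $|\gamma_1\cap\dots\cap\gamma_\ell|=1$ for all $\gamma_1\in\Gamma_1,\dots,\gamma_\ell\in\Gamma_\ell$. It is *$G$-invariant* if $G$ permutes the $\Gamma_i$. $\mathrm{CD}_{\mathrm{tr}}(G)$ is the set of $G$-invariant Cartesian decompositions on which $G$ acts transitively. For a $G$-invariant Cartesian decomposition $\mathcal E=\{\Gamma_1,\dots,\Gamma_\ell\}$, with $G$ innately transitive with plinth $M$, it is known that each $\Gamma_i$ is $M$-invariant; let $\gamma_i\in\Gamma_i$ be the block containing $\omega$ and $\mathcal K_\omega(\mathcal E)=\{K_1,\dots,K_\ell\}$ with $K_i=M_{\gamma_i}$ (setwise stabiliser). It is known that $\mathcal E\mapsto\mathcal K_\omega(\mathcal E)$ is a bijection from the $G$-invariant Cartesian decompositions to the $G_\omega$-invariant (under conjugation) sets $\{K_1,\dots,K_\ell\}$ of proper subgroups of $M$ satisfying $\bigcap_i K_i=M_\omega$ and $K_i(\bigcap_{j\ne i}K_j)=M$ for all $i$. $\sigma_i:M\to T_i$ is the projection. Put $\mathcal F_i(\mathcal E,M,\omega)=\{\sigma_i(K_j): 1\le j\le\ell,\ \sigma_i(K_j)\neq T_i\}$. $\mathrm{CD}_{2\sim}(G)$ is the set of $\mathcal E\in\mathrm{CD}_{\mathrm{tr}}(G)$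 such that, for each $i$, $|\mathcal F_i|=2$ and the two subgroups in $\mathcal F_i$ are $G_\omega$-conjugate. A *generalised graph* is a triple $(V,E,\varepsilon)$ with $V$, $E$ disjoint sets (vertices, edges), $V\neq\emptyset$, and a map $\varepsilon:E\to\{\{v_1,v_2\}: v_1,v_2\in V, v_1\ne v_2\}$. An automorphism is $\alpha\in\mathrm{Sym}\,V\times\mathrm{Sym}\,E$ with $\varepsilon(\alpha(e))=\alpha(\varepsilon(e))$ for all $e\in E$. For $\mathcal E\in\mathrm{CD}_{2\sim}(G)$, $\Gamma(G,\mathcal E)$ is the generalised graph $(\mathcal K_\omega(\mathcal E),\mathcal T,\varepsilon)$ where $\varepsilon(T_i)=\{K_{j_1},K_{j_2}\}$ consists of the two members $K$ of $\mathcal K_\omega(\mathcal E)$ with $\sigma_i(K)\ne T_i$. *)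

theory Defs
  imports "HOL-Algebra.Algebra" "HOL-Library.Disjoint_Sets"
begin

text \<open>
  In \<open>BijGroup \<Omega>\<close> the product of \<open>f\<close> and \<open>g\<close> is the function \<open>f \<circ> g\<close>, so permutations are written
  on the left. With permutations written on the right, the conjugate of \<open>x\<close> by \<open>g\<close> is
  ``first the inverse of \<open>g\<close>, then \<open>x\<close>, then \<open>g\<close>''; here the same function is
  \<open>g \<otimes> x \<otimes> inv g\<close>. Likewise an action on the right of a permutation group is, as a map into
  permutations, a homomorphism into \<open>BijGroup\<close> with its left-handed product.
\<close>

subsection \<open>Permutation groups\<close>

abbreviation perm_group :: "'a set \<Rightarrow> ('a \<Rightarrow> 'a) set \<Rightarrow> ('a \<Rightarrow> 'a) monoid" where
  "perm_group \<Omega> G \<equiv> (BijGroup \<Omega>)\<lparr>carrier := G\<rparr>"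

definition conj_set :: "('g, 'm) monoid_scheme \<Rightarrow> 'g \<Rightarrow> 'g set \<Rightarrow> 'g set" where
  "conj_set S g H = g <#\<^bsub>S\<^esub> H #>\<^bsub>S\<^esub> (inv\<^bsub>S\<^esub> g)"

definition minimal_normal :: "('g, 'm) monoid_scheme \<Rightarrow> 'g set \<Rightarrow> bool" where
  "minimal_normal G M \<longleftrightarrow>
     M \<lhd> G \<and> M \<noteq> {\<one>\<^bsub>G\<^esub>} \<and>
     (\<forall>N. N \<lhd> G \<and> N \<subseteq> M \<longrightarrow> N = {\<one>\<^bsub>G\<^esub>} \<or> N = M)"

definition plinth :: "'a set \<Rightarrow> ('a \<Rightarrow> 'a) set \<Rightarrow> ('a \<Rightarrow> 'a) set \<Rightarrow> bool" where
  "plinth \<Omega> G M \<longleftrightarrow>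
     minimal_normal (perm_group \<Omega> G) M \<and> transitive_action (perm_group \<Omega> M) \<Omega> (\<lambda>g. g)"

definition innately_transitive :: "'a set \<Rightarrow> ('a \<Rightarrow> 'a) set \<Rightarrow> bool" where
  "innately_transitive \<Omega> G \<longleftrightarrow> subgroup G (BijGroup \<Omega>) \<and> (\<exists>M. plinth \<Omega> G M)"

definition point_stab :: "'a set \<Rightarrow> ('a \<Rightarrow> 'a) set \<Rightarrow> 'a \<Rightarrow> ('a \<Rightarrow> 'a) set" where
  "point_stab \<Omega> G \<omega> = stabilizer (perm_group \<Omega> G) (\<lambda>g. g) \<omega>"

definition set_stab :: "'a set \<Rightarrow> ('a \<Rightarrow> 'a) set \<Rightarrow> 'a set \<Rightarrow> ('a \<Rightarrow> 'a) set" where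
  "set_stab \<Omega> G \<gamma> = stabilizer (perm_group \<Omega> G) (\<lambda>g \<delta>. g ` \<delta>) \<gamma>"

subsection \<open>Internal direct products\<close>

definition internal_direct_product ::
    "('g, 'm) monoid_scheme \<Rightarrow> 'i set \<Rightarrow> ('i \<Rightarrow> 'g set) \<Rightarrow> bool" where
  "internal_direct_product G I H \<longleftrightarrow>
     (\<forall>i\<in>I. H i \<lhd> G) \<and>
     generate G (\<Union>i\<in>I. H i) = carrier G \<and>
     (\<forall>i\<in>I. H i \<inter> generate G (\<Union>j\<in>I - {i}. H j) = {\<one>\<^bsub>G\<^esub>})"

definition dproj ::
    "('g, 'm) monoid_scheme \<Rightarrow> 'i set \<Rightarrow> ('i \<Rightarrow> 'g set) \<Rightarrow> 'i \<Rightarrow> 'g \<Rightarrow> 'g" where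
  "dproj G I H i x =
     (THE t. t \<in> H i \<and> (\<exists>c \<in> generate G (\<Union>j\<in>I - {i}. H j). x = t \<otimes>\<^bsub>G\<^esub> c))"

definition simple_direct_factors ::
    "('g, 'm) monoid_scheme \<Rightarrow> nat \<Rightarrow> (nat \<Rightarrow> 'g set) \<Rightarrow> bool" where
  "simple_direct_factors M k T \<longleftrightarrow>
     internal_direct_product M {1..k} T \<and> (\<forall>i\<in>{1..k}. simple_group (M\<lparr>carrier := T i\<rparr>))"

subsection \<open>Cartesian decompositions\<close>

text \<open>
  A partition is proper if it has more than one block. The partition into singletons is proper
  when \<open>\<Omega>\<close> has at least two points, so a Cartesian decomposition may have just one member.
\<close>

definition proper_partition :: "'a set \<Rightarrow> 'a set set \<Rightarrow> bool" where
  "proper_partition \<Omega> \<Gamma> \<longleftrightarrow> partition_on \<Omega> \<Gamma> \<and> \<Gamma> \<noteq> {\<Omega>}"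

definition cartesian_decomposition :: "'a set \<Rightarrow> 'a set set set \<Rightarrow> bool" where
  "cartesian_decomposition \<Omega> \<E> \<longleftrightarrow>
     finite \<E> \<and> \<E> \<noteq> {} \<and> (\<forall>\<Gamma>\<in>\<E>. proper_partition \<Omega> \<Gamma>) \<and>
     (\<forall>\<gamma> \<in> (\<Pi> \<Gamma>\<in>\<E>. \<Gamma>). card (\<Inter>\<Gamma>\<in>\<E>. \<gamma> \<Gamma>) = 1)"

definition move_partition :: "('a \<Rightarrow> 'a) \<Rightarrow> 'a set set \<Rightarrow> 'a set set" where
  "move_partition g \<Gamma> = (\<lambda>\<gamma>. g ` \<gamma>) ` \<Gamma>"

definition invariant_CD :: "('a \<Rightarrow> 'a) set \<Rightarrow> 'a set set set \<Rightarrow> bool" where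
  "invariant_CD G \<E> \<longleftrightarrow> (\<forall>g\<in>G. move_partition g ` \<E> = \<E>)"

definition CD_tr :: "'a set \<Rightarrow> ('a \<Rightarrow> 'a) set \<Rightarrow> 'a set set set set" where
  "CD_tr \<Omega> G = {\<E>. cartesian_decomposition \<Omega> \<E> \<and> invariant_CD G \<E> \<and>
     (\<forall>\<Gamma>\<in>\<E>. \<forall>\<Delta>\<in>\<E>. \<exists>g\<in>G. move_partition g \<Gamma> = \<Delta>)}"

definition CD_subgroups ::
    "'a set \<Rightarrow> ('a \<Rightarrow> 'a) set \<Rightarrow> 'a \<Rightarrow> 'a set set set \<Rightarrow> ('a \<Rightarrow> 'a) set set" where
  "CD_subgroups \<Omega> M \<omega> \<E> = {set_stab \<Omega> M \<gamma> | \<Gamma> \<gamma>. \<Gamma> \<in> \<E> \<and> \<gamma> \<in> \<Gamma> \<and> \<omega> \<in> \<gamma>}"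

definition CD_factors ::
    "'a set \<Rightarrow> ('a \<Rightarrow> 'a) set \<Rightarrow> nat \<Rightarrow> (nat \<Rightarrow> ('a \<Rightarrow> 'a) set) \<Rightarrow> 'a \<Rightarrow>
     'a set set set \<Rightarrow> nat \<Rightarrow> ('a \<Rightarrow> 'a) set set" where
  "CD_factors \<Omega> M k T \<omega> \<E> i =
     {dproj (perm_group \<Omega> M) {1..k} T i ` K | K.
        K \<in> CD_subgroups \<Omega> M \<omega> \<E> \<and> dproj (perm_group \<Omega> M) {1..k} T i ` K \<noteq> T i}"

definition CD_2sim ::
    "'a set \<Rightarrow> ('a \<Rightarrow> 'a) set \<Rightarrow> ('a \<Rightarrow> 'a) set \<Rightarrow> nat \<Rightarrow> (nat \<Rightarrow> ('a \<Rightarrow> 'a) set) \<Rightarrow> 'a \<Rightarrow>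
     'a set set set set" where
  "CD_2sim \<Omega> G M k T \<omega> = {\<E> \<in> CD_tr \<Omega> G. \<forall>i\<in>{1..k}.
     card (CD_factors \<Omega> M k T \<omega> \<E> i) = 2 \<and>
     (\<forall>A \<in> CD_factors \<Omega> M k T \<omega> \<E> i. \<forall>B \<in> CD_factors \<Omega> M k T \<omega> \<E> i.
        \<exists>g \<in> point_stab \<Omega> G \<omega>. conj_set (BijGroup \<Omega>) g A = B)}"

subsection \<open>Generalised graphs\<close>

text \<open>
  Vertices and edges belong to two separate type parameters, so disjointness of the vertex set and
  the edge set is built in, also when both parameters are instantiated with the same type.
\<close>

record ('v, 'e) gen_graph =
  verts :: "'v set"
  edges :: "'e set"
  ends :: "'e \<Rightarrow> 'v set"

definition generalised_graph :: "('v, 'e) gen_graph \<Rightarrow> bool" where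
  "generalised_graph \<Gamma> \<longleftrightarrow> verts \<Gamma> \<noteq> {} \<and>
     (\<forall>e\<in>edges \<Gamma>. ends \<Gamma> e \<in> {{v\<^sub>1, v\<^sub>2} | v\<^sub>1 v\<^sub>2. v\<^sub>1 \<in> verts \<Gamma> \<and> v\<^sub>2 \<in> verts \<Gamma> \<and> v\<^sub>1 \<noteq> v\<^sub>2})"

definition gen_graph_aut :: "('v, 'e) gen_graph \<Rightarrow> (('v \<Rightarrow> 'v) \<times> ('e \<Rightarrow> 'e)) set" where
  "gen_graph_aut \<Gamma> = {(\<alpha>, \<beta>). \<alpha> \<in> Bij (verts \<Gamma>) \<and> \<beta> \<in> Bij (edges \<Gamma>) \<and>
     (\<forall>e\<in>edges \<Gamma>. ends \<Gamma> (\<beta> e) = \<alpha> ` ends \<Gamma> e)}"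

definition gen_graph_isomorphic :: "('v, 'e) gen_graph \<Rightarrow> ('w, 'f) gen_graph \<Rightarrow> bool" where
  "gen_graph_isomorphic \<Gamma> \<Delta> \<longleftrightarrow> generalised_graph \<Gamma> \<and> generalised_graph \<Delta> \<and>
     (\<exists>\<alpha> \<beta>. bij_betw \<alpha> (verts \<Gamma>) (verts \<Delta>) \<and> bij_betw \<beta> (edges \<Gamma>) (edges \<Delta>) \<and>
        (\<forall>e\<in>edges \<Gamma>. ends \<Delta> (\<beta> e) = \<alpha> ` ends \<Gamma> e))"

definition CD_graph ::
    "'a set \<Rightarrow> ('a \<Rightarrow> 'a) set \<Rightarrow> nat \<Rightarrow> (nat \<Rightarrow> ('a \<Rightarrow> 'a) set) \<Rightarrow> 'a \<Rightarrow> 'a set set set \<Rightarrow>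
     (('a \<Rightarrow> 'a) set, ('a \<Rightarrow> 'a) set) gen_graph" where
  "CD_graph \<Omega> M k T \<omega> \<E> =
     \<lparr>verts = CD_subgroups \<Omega> M \<omega> \<E>,
      edges = T ` {1..k},
      ends = (\<lambda>t. {K \<in> CD_subgroups \<Omega> M \<omega> \<E>.
        \<exists>i\<in>{1..k}. t = T i \<and> dproj (perm_group \<Omega> M) {1..k} T i ` K \<noteq> T i})\<rparr>"

end

theory Submission
  imports Defs
begin

text \<open>
  For a vertex \<open>v\<close> let \<open>K v\<close> be the set of all \<open>x \<in> M\<close> such that, for every element \<open>g\<close> of the point
  stabiliser taking the arc \<open>(v\<^sub>1, T\<^sub>1)\<close> to an arc \<open>(v, T\<^sub>i)\<close>, the component of \<open>x\<close> in \<open>T\<^sub>i\<close> lies in the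
  conjugate of \<open>A\<^sub>1\<close> by \<open>g\<close>. An element taking \<open>A\<^sub>1\<close> to \<open>B\<^sub>1\<close> normalises \<open>T\<^sub>1\<close>, hence swaps \<open>A\<^sub>1\<close> with
  \<open>B\<^sub>1\<close> and \<open>v\<^sub>1\<close> with \<open>v\<^sub>2\<close>; therefore the stabiliser is transitive on arcs, and the two end vertices of
  \<open>T\<^sub>i\<close> impose conditions by a conjugate of \<open>A\<^sub>1\<close> and the same conjugate of \<open>B\<^sub>1\<close>. Since
  \<open>A\<^sub>1 B\<^sub>1 = T\<^sub>1\<close>, any family of cosets of the groups \<open>K v\<close> has a common element, and since
  \<open>A\<^sub>1 \<inter> B\<^sub>1\<close> is the projection of \<open>M\<^sub>\<omega>\<close>, the groups \<open>K v\<close> intersect in \<open>M\<^sub>\<omega>\<close>. The coset partitions of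
  the \<open>K v\<close> form the required decomposition.
\<close>

subsection \<open>Projections of internal direct products\<close>

locale internal_product = group D for D (structure) +
  fixes I :: "'i set" and H :: "'i \<Rightarrow> 'a set"
  assumes finite_index: "finite I"
    and internal: "internal_direct_product D I H"
begin

abbreviation cofactor :: "'i \<Rightarrow> 'a set" where
  "cofactor i \<equiv> generate D (\<Union>j\<in>I - {i}. H j)"

abbreviation proj :: "'i \<Rightarrow> 'a \<Rightarrow> 'a" where
  "proj \<equiv> dproj D I H"

lemma factor_normal: "i \<in> I \<Longrightarrow> H i \<lhd> D"
  and factors_generate: "generate D (\<Union>i\<in>I. H i) = carrier D"
  and factor_cofactor_disjoint: "i \<in> I \<Longrightarrow> H i \<inter> cofactor i = {\<one>}"
  using internal unfolding internal_direct_product_def by blast+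

lemma factor_subgroup: "i \<in> I \<Longrightarrow> subgroup (H i) D"
  using factor_normal normal_imp_subgroup by blast

lemma factor_carrier: "i \<in> I \<Longrightarrow> x \<in> H i \<Longrightarrow> x \<in> carrier D"
  using factor_subgroup subgroup.mem_carrier by metis

lemma generate_factors_normal:
  assumes "J \<subseteq> I"
  shows "generate D (\<Union>j\<in>J. H j) \<lhd> D"
proof (rule normal_generateI)
  show "(\<Union>j\<in>J. H j) \<subseteq> carrier D"
    using assms factor_carrier by blast
next
  fix h g assume "h \<in> (\<Union>j\<in>J. H j)" "g \<in> carrier D"
  then show "g \<otimes> h \<otimes> inv g \<in> (\<Union>j\<in>J. H j)"
    using assms normal.inv_op_closed2[OF factor_normal] by blast
qed

lemma cofactor_normal: "cofactor i \<lhd> D"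
  by (rule generate_factors_normal) blast

lemma factor_sub_cofactor: "i \<in> I \<Longrightarrow> j \<noteq> i \<Longrightarrow> H i \<subseteq> cofactor j"
  by (auto intro!: generate.incl)

lemma cofactor_carrier: "x \<in> cofactor i \<Longrightarrow> x \<in> carrier D"
  using normal_imp_subgroup[OF cofactor_normal] subgroup.mem_carrier by metis

lemma factor_cofactor_commute:
  assumes "i \<in> I" "x \<in> H i" "y \<in> cofactor i"
  shows "x \<otimes> y = y \<otimes> x"
  using normal_imp_commuting[OF factor_normal cofactor_normal] factor_cofactor_disjoint assms
  by blast

text \<open>The product of the normal subgroup \<open>H i\<close> with the subgroup generated by the
  factors in \<open>J\<close> is itself a subgroup, and it contains all the generators.\<close>

lemma generate_factors_insert:
  assumes "i \<in> I" "J \<subseteq> I" "x \<in> generate D (\<Union>j\<in>insert i J. H j)"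
  shows "\<exists>t\<in>H i. \<exists>c\<in>generate D (\<Union>j\<in>J. H j). x = t \<otimes> c"
proof -
  let ?C = "generate D (\<Union>j\<in>J. H j)"
  have C: "?C \<lhd> D" by (rule generate_factors_normal[OF assms(2)])
  have sub: "subgroup (H i <#> ?C) D"
    using mult_norm_subgroup[OF factor_normal[OF assms(1)] normal_imp_subgroup[OF C]] .
  have "(\<Union>j\<in>insert i J. H j) \<subseteq> H i <#> ?C"
  proof
    fix y assume "y \<in> (\<Union>j\<in>insert i J. H j)"
    then consider "y \<in> H i" | "y \<in> ?C" by (auto intro: generate.incl)
    then show "y \<in> H i <#> ?C"
    proof cases
      case 1
      then have "y = y \<otimes> \<one>" using factor_carrier[OF assms(1)] by simp
      then show ?thesis using 1 generate.one[of D] unfolding set_mult_def by blast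
    next
      case 2
      then have "y = \<one> \<otimes> y" using subgroup.mem_carrier[OF normal_imp_subgroup[OF C]] by simp
      then show ?thesis
        using 2 subgroup.one_closed[OF factor_subgroup[OF assms(1)]] unfolding set_mult_def by blast
    qed
  qed
  then have "x \<in> H i <#> ?C"
    using generate_subgroup_incl[OF _ sub] assms(3) by blast
  then show ?thesis unfolding set_mult_def by auto
qed

lemma factorise:
  assumes "i \<in> I" "x \<in> carrier D"
  shows "\<exists>t\<in>H i. \<exists>c\<in>cofactor i. x = t \<otimes> c"
proof -
  have "insert i (I - {i}) = I" using assms(1) by blast
  then show ?thesis
    using generate_factors_insert[OF assms(1), of "I - {i}" x] factors_generate assms(2) by auto
qed

text \<open>\<open>dproj\<close> is a definite description, so evaluating it requires uniqueness:
  two factorisations of one element differ by an element of \<open>H i\<close> that also lies in the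
  cofactor, and these meet trivially.\<close>

lemma proj_eqI:
  assumes i: "i \<in> I" and t: "t \<in> H i" and c: "c \<in> cofactor i"
  shows "proj i (t \<otimes> c) = t"
  unfolding dproj_def
proof (rule the_equality)
  show "t \<in> H i \<and> (\<exists>c'\<in>cofactor i. t \<otimes> c = t \<otimes> c')" using t c by blast
next
  fix s assume "s \<in> H i \<and> (\<exists>d\<in>cofactor i. t \<otimes> c = s \<otimes> d)"
  then obtain d where s: "s \<in> H i" and d: "d \<in> cofactor i" and eq: "t \<otimes> c = s \<otimes> d" by blast
  have carr: "t \<in> carrier D" "s \<in> carrier D" "c \<in> carrier D" "d \<in> carrier D"
    using factor_carrier[OF i] cofactor_carrier s t c d by auto
  have "inv s \<otimes> t = d \<otimes> inv c"
    using eq carr by (metis inv_closed inv_solve_left inv_solve_right m_assoc m_closed)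
  moreover have "inv s \<otimes> t \<in> H i"
    using factor_subgroup[OF i] s t by (simp add: subgroup.m_closed subgroup.m_inv_closed)
  moreover have "d \<otimes> inv c \<in> cofactor i"
    using normal_imp_subgroup[OF cofactor_normal[of i]] c d
    by (simp add: subgroup.m_closed subgroup.m_inv_closed)
  ultimately have "inv s \<otimes> t = \<one>"
    using factor_cofactor_disjoint[OF i] by auto
  then show "s = t" using carr by (metis inv_equality inv_inv inv_closed)
qed

lemma proj_mem: "i \<in> I \<Longrightarrow> x \<in> carrier D \<Longrightarrow> proj i x \<in> H i"
  using factorise proj_eqI by metis

lemma proj_factor: "i \<in> I \<Longrightarrow> t \<in> H i \<Longrightarrow> proj i t = t"
  using proj_eqI[OF _ _ generate.one, of i t] factor_carrier by simp

lemma proj_cofactor: "i \<in> I \<Longrightarrow> c \<in> cofactor i \<Longrightarrow> proj i c = \<one>"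
  using proj_eqI[of i \<one> c] cofactor_carrier[of c i] subgroup.one_closed[OF factor_subgroup]
  by simp

lemma proj_other: "i \<in> I \<Longrightarrow> j \<in> I \<Longrightarrow> j \<noteq> i \<Longrightarrow> t \<in> H j \<Longrightarrow> proj i t = \<one>"
  using proj_cofactor[of i t] factor_sub_cofactor[of j i] by (simp add: subset_iff)

text \<open>\<open>H i\<close> and its cofactor are normal with trivial intersection, so they
  commute elementwise and the two middle terms of the product can be exchanged.\<close>

lemma proj_mult:
  assumes i: "i \<in> I" and "x \<in> carrier D" "y \<in> carrier D"
  shows "proj i (x \<otimes> y) = proj i x \<otimes> proj i y"
proof -
  obtain t c where tc: "t \<in> H i" "c \<in> cofactor i" "x = t \<otimes> c" using factorise assms by blast
  obtain s d where sd: "s \<in> H i" "d \<in> cofactor i" "y = s \<otimes> d" using factorise assms by blast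
  have carr: "t \<in> carrier D" "s \<in> carrier D" "c \<in> carrier D" "d \<in> carrier D"
    using factor_carrier[OF i] cofactor_carrier tc sd by auto
  have "x \<otimes> y = t \<otimes> (c \<otimes> s) \<otimes> d" using carr tc sd by (simp add: m_assoc)
  also have "\<dots> = t \<otimes> (s \<otimes> c) \<otimes> d"
    using factor_cofactor_commute[OF i sd(1) tc(2)] by simp
  also have "\<dots> = (t \<otimes> s) \<otimes> (c \<otimes> d)" using carr by (simp add: m_assoc)
  finally have "x \<otimes> y = (t \<otimes> s) \<otimes> (c \<otimes> d)" .
  moreover have "t \<otimes> s \<in> H i" using factor_subgroup[OF i] tc sd by (simp add: subgroup.m_closed)
  moreover have "c \<otimes> d \<in> cofactor i" using tc sd by (simp add: generate.eng)
  ultimately show ?thesis using proj_eqI[OF i] tc sd by metis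
qed

lemma proj_group_hom: "i \<in> I \<Longrightarrow> group_hom D D (proj i)"
  by (unfold_locales) (auto simp: hom_def proj_mult intro: factor_carrier proj_mem)

lemma proj_inv: "i \<in> I \<Longrightarrow> x \<in> carrier D \<Longrightarrow> proj i (inv x) = inv (proj i x)"
  using group_hom.hom_inv[OF proj_group_hom] .

section \<open>Elements are determined by their components, which can be prescribed freely\<close>

lemma proj_trivial_imp_one:
  assumes "J \<subseteq> I" "x \<in> generate D (\<Union>j\<in>J. H j)" "\<And>j. j \<in> J \<Longrightarrow> proj j x = \<one>"
  shows "x = \<one>"
proof -
  have "finite J" using assms(1) finite_index finite_subset by blast
  then show ?thesis using assms
  proof (induction J arbitrary: x)
    case empty
    then show ?case using generate_empty by simp
  next
    case (insert j J)
    \<comment> \<open>The part \<open>t\<close> split off is the component of \<open>x\<close> at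
      \<open>j\<close>, hence trivial, and the induction hypothesis applies to the rest.\<close>
    then obtain t c where t: "t \<in> H j" and c: "c \<in> generate D (\<Union>j\<in>J. H j)" and x: "x = t \<otimes> c"
      using generate_factors_insert[of j J x] by auto
    have "c \<in> cofactor j"
      using c mono_generate[of "\<Union>j\<in>J. H j" "\<Union>l\<in>I - {j}. H l"] insert.hyps insert.prems(1) by blast
    then have "proj j x = t" using proj_eqI x t insert.prems(1) by auto
    then have "t = \<one>" using insert.prems(3) by simp
    then have "x = c"
      using x cofactor_carrier[OF \<open>c \<in> cofactor j\<close>] by simp
    then show ?case using insert c by auto
  qed
qed

lemma proj_ext:
  assumes "x \<in> carrier D" "y \<in> carrier D" "\<And>i. i \<in> I \<Longrightarrow> proj i x = proj i y"
  shows "x = y"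
proof -
  have "proj i (x \<otimes> inv y) = \<one>" if "i \<in> I" for i
    using that assms by (simp add: proj_mult proj_inv factor_carrier[OF that proj_mem])
  then have "x \<otimes> inv y = \<one>"
    using proj_trivial_imp_one[of I] factors_generate assms by simp
  then show ?thesis using assms by (metis inv_closed inv_equality inv_inv)
qed

text \<open>The element is the product of the \<open>t i\<close>, built one index at a time:
  multiplying by \<open>t j\<close> changes only the component at \<open>j\<close>, and all the
  \<open>t i\<close> lie in \<open>K\<close>.\<close>

lemma ex_proj_subgroup:
  assumes K: "subgroup K D" and t: "\<And>i. i \<in> I \<Longrightarrow> t i \<in> H i \<inter> K"
  shows "\<exists>x\<in>K. \<forall>i\<in>I. proj i x = t i"
proof -
  \<comment> \<open>Components at indices not yet treated are kept at \<open>\<one>\<close>, so the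
    induction starts from the identity.\<close>
  have "\<exists>x\<in>K. \<forall>i\<in>I. proj i x = (if i \<in> J then t i else \<one>)" if "J \<subseteq> I" for J
  proof -
    have "finite J" using that finite_index finite_subset by blast
    then show ?thesis using that
    proof (induction J)
      case empty
      then show ?case
        using subgroup.one_closed[OF K] group_hom.hom_one[OF proj_group_hom] by auto
    next
      case (insert j J)
      then obtain x where x: "x \<in> K" "\<forall>i\<in>I. proj i x = (if i \<in> J then t i else \<one>)" by blast
      have j: "j \<in> I" using insert by simp
      have carr: "x \<in> carrier D" "t j \<in> carrier D"
        using x K t[OF j] subgroup.mem_carrier by fast+
      have "proj i (t j \<otimes> x) = (if i \<in> insert j J then t i else \<one>)" if "i \<in> I" for i
        using that x(2) carr proj_mult[OF that carr(2,1)] proj_other[OF that j] proj_factor[OF j]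
          t[OF j] t[OF that] insert.hyps(2) factor_carrier[OF that]
        by (cases "i = j") auto
      moreover have "t j \<otimes> x \<in> K" using x t[OF j] K by (simp add: subgroup.m_closed)
      ultimately show ?case by blast
    qed
  qed
  from this[of I] show ?thesis by auto
qed

text \<open>Some element of \<open>K\<close> has the same components as \<open>x\<close> and
  therefore equals \<open>x\<close>. Membership in a point stabiliser is checked factor by factor in
  this way.\<close>

lemma mem_subgroupI:
  assumes "subgroup K D" "x \<in> carrier D" "\<And>i. i \<in> I \<Longrightarrow> proj i x \<in> K"
  shows "x \<in> K"
proof -
  obtain y where "y \<in> K" "\<forall>i\<in>I. proj i y = proj i x"
    using ex_proj_subgroup[OF assms(1), of "\<lambda>i. proj i x"] assms proj_mem by blast
  then show ?thesis using proj_ext[of y x] assms subgroup.mem_carrier by metis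
qed

lemma ex_proj:
  assumes "\<And>i. i \<in> I \<Longrightarrow> t i \<in> H i"
  shows "\<exists>x\<in>carrier D. \<forall>i\<in>I. proj i x = t i"
  using ex_proj_subgroup[OF subgroup_self, of t] assms factor_carrier by blast

text \<open>Meant for conjugations, which permute the factors. The factors other than
  \<open>H i\<close> go into factors other than \<open>H j\<close>, so the cofactor of
  \<open>i\<close> goes into that of \<open>j\<close> and a factorisation at \<open>i\<close>
  becomes one at \<open>j\<close>.\<close>

lemma proj_hom_swap:
  assumes \<alpha>: "\<alpha> \<in> hom D D" and i: "i \<in> I" and j: "j \<in> I" and ij: "\<alpha> ` H i \<subseteq> H j"
    and others: "\<And>l. l \<in> I \<Longrightarrow> l \<noteq> i \<Longrightarrow> \<exists>m\<in>I. m \<noteq> j \<and> \<alpha> ` H l \<subseteq> H m"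
    and x: "x \<in> carrier D"
  shows "proj j (\<alpha> x) = \<alpha> (proj i x)"
proof -
  interpret \<alpha>: group_hom D D \<alpha> using \<alpha> by unfold_locales
  obtain t c where tc: "t \<in> H i" "c \<in> cofactor i" "x = t \<otimes> c" using factorise[OF i x] by blast
  have "(\<Union>l\<in>I - {i}. H l) \<subseteq> carrier D" using factor_carrier by blast
  then have "\<alpha> ` cofactor i = generate D (\<alpha> ` (\<Union>l\<in>I - {i}. H l))"
    using \<alpha>.generate_img by simp
  also have "\<dots> \<subseteq> cofactor j"
    by (rule mono_generate) (use others in blast)
  finally have "\<alpha> c \<in> cofactor j" using tc by blast
  moreover have "\<alpha> t \<in> H j" using ij tc by blast
  moreover have "\<alpha> x = \<alpha> t \<otimes> \<alpha> c"
    using tc factor_carrier[OF i] cofactor_carrier by simp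
  ultimately show ?thesis using proj_eqI i j tc by metis
qed

end

subsection \<open>Conjugation\<close>

context group
begin

lemma conj_set_eq_image: "conj_set G g H = (\<lambda>x. g \<otimes> x \<otimes> inv g) ` H"
  unfolding conj_set_def l_coset_def r_coset_def by auto

lemma conj_conj:
  "\<lbrakk>g \<in> carrier G; h \<in> carrier G; x \<in> carrier G\<rbrakk> \<Longrightarrow>
    g \<otimes> (h \<otimes> x \<otimes> inv h) \<otimes> inv g = (g \<otimes> h) \<otimes> x \<otimes> inv (g \<otimes> h)"
  by (simp add: inv_mult_group m_assoc)

lemma conj_set_mult:
  "\<lbrakk>g \<in> carrier G; h \<in> carrier G; H \<subseteq> carrier G\<rbrakk> \<Longrightarrow>
    conj_set G (g \<otimes> h) H = conj_set G g (conj_set G h H)"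
  unfolding conj_set_eq_image image_image
  by (rule image_cong) (auto simp: conj_conj subset_iff)

lemma conj_set_one: "H \<subseteq> carrier G \<Longrightarrow> conj_set G \<one> H = H"
  unfolding conj_set_eq_image by (force simp: subset_iff image_iff)

lemma conj_set_closed:
  "\<lbrakk>g \<in> carrier G; H \<subseteq> carrier G\<rbrakk> \<Longrightarrow> conj_set G g H \<subseteq> carrier G"
  unfolding conj_set_eq_image by auto

lemma conj_inj: "g \<in> carrier G \<Longrightarrow> inj_on (\<lambda>x. g \<otimes> x \<otimes> inv g) (carrier G)"
  by (rule inj_onI) simp

lemma conj_set_cancel:
  "\<lbrakk>g \<in> carrier G; H \<subseteq> carrier G; K \<subseteq> carrier G\<rbrakk> \<Longrightarrow>
    conj_set G g H = conj_set G g K \<longleftrightarrow> H = K"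
  unfolding conj_set_eq_image using inj_on_image_eq_iff[OF conj_inj] by blast

lemma conj_set_inv_iff:
  assumes "g \<in> carrier G" "H \<subseteq> carrier G" "K \<subseteq> carrier G"
  shows "conj_set G (inv g) H = K \<longleftrightarrow> H = conj_set G g K"
proof -
  have "conj_set G g (conj_set G (inv g) H) = H"
    using conj_set_mult[of g "inv g" H] assms conj_set_one by simp
  then show ?thesis
    using conj_set_cancel[OF assms(1) conj_set_closed[of "inv g" H] assms(3)] assms by auto
qed

text \<open>Containment for \<open>inv g\<close>, conjugated by \<open>g\<close>, supplies the
  reverse inclusion.\<close>

lemma conj_set_eq_self:
  assumes "subgroup S G" "g \<in> S" "H \<subseteq> carrier G" "\<And>s. s \<in> S \<Longrightarrow> conj_set G s H \<subseteq> H"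
  shows "conj_set G g H = H"
proof
  have g: "g \<in> carrier G" "inv g \<in> S"
    using assms(1,2) by (auto simp: subgroup.mem_carrier subgroup.m_inv_closed)
  have "conj_set G g (conj_set G (inv g) H) \<subseteq> conj_set G g H"
    using assms(4)[OF g(2)] unfolding conj_set_eq_image by blast
  then show "H \<subseteq> conj_set G g H"
    using conj_set_mult[of g "inv g" H] conj_set_one[of H] g assms(3) by simp
qed (use assms in blast)

lemma mem_normalizer_iff:
  "H \<subseteq> carrier G \<Longrightarrow> g \<in> normalizer G H \<longleftrightarrow> g \<in> carrier G \<and> conj_set G g H = H"
  unfolding normalizer_def stabilizer_def conj_set_def by simp

lemma conj_subgroup:
  assumes "subgroup H G" "g \<in> carrier G"
  shows "subgroup (conj_set G g H) G"
proof -
  have "(\<lambda>x. g \<otimes> x \<otimes> inv g) \<in> hom G G"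
  proof (rule homI)
    fix x y assume xy: "x \<in> carrier G" "y \<in> carrier G"
    then have "inv g \<otimes> (g \<otimes> (y \<otimes> inv g)) = y \<otimes> inv g"
      using assms(2) by (simp add: m_assoc[symmetric])
    then show "g \<otimes> (x \<otimes> y) \<otimes> inv g = (g \<otimes> x \<otimes> inv g) \<otimes> (g \<otimes> y \<otimes> inv g)"
      using xy assms(2) by (simp add: m_assoc)
  qed (use assms in simp)
  then interpret group_hom G G "\<lambda>x. g \<otimes> x \<otimes> inv g" by unfold_locales
  show ?thesis unfolding conj_set_eq_image by (rule subgroup_img_is_subgroup[OF assms(1)])
qed

end

subsection \<open>The subgroups attached to the vertices\<close>

text \<open>In the application \<open>P\<close> is \<open>BijGroup \<Omega>\<close>,
  \<open>M\<close> the plinth, \<open>S\<close> and \<open>W\<close> are the stabilisers of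
  \<open>\<omega>\<close> in \<open>G\<close> and in \<open>M\<close>, and \<open>b\<close> is the
  index 1. Points of \<open>\<Omega>\<close> do not occur: this is the subgroup side of the
  correspondence between decompositions and families of subgroups.\<close>

locale arc_transitive_data = group P for P :: "('g, 'm) monoid_scheme" (structure) +
  fixes M S W :: "'g set" and I :: "'i set" and T :: "'i \<Rightarrow> 'g set" and b :: 'i
    and A B :: "'g set"
    and \<phi> :: "'g \<Rightarrow> 'v \<Rightarrow> 'v" and V :: "'v set" and ends :: "'g set \<Rightarrow> 'v set"
    and v\<^sub>1 v\<^sub>2 :: 'v
  assumes subgroup_M: "subgroup M P" and subgroup_S: "subgroup S P"
    and subgroup_W: "subgroup W P" and W_sub_M: "W \<subseteq> M"
    and conj_M: "\<And>g x. \<lbrakk>g \<in> S; x \<in> M\<rbrakk> \<Longrightarrow> g \<otimes> x \<otimes> inv g \<in> M"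
    and conj_W: "\<And>g x. \<lbrakk>g \<in> S; x \<in> W\<rbrakk> \<Longrightarrow> g \<otimes> x \<otimes> inv g \<in> W"
    and finite_I: "finite I" and b: "b \<in> I"
    and direct: "internal_direct_product (P\<lparr>carrier := M\<rparr>) I T"
    and factor_nontrivial: "\<And>i. i \<in> I \<Longrightarrow> T i \<noteq> {\<one>}"
    and proj_W: "\<And>i. i \<in> I \<Longrightarrow> dproj (P\<lparr>carrier := M\<rparr>) I T i ` W \<subseteq> W"
    and conj_factor: "\<And>g i. \<lbrakk>g \<in> S; i \<in> I\<rbrakk> \<Longrightarrow> \<exists>j\<in>I. conj_set P g (T i) = T j"
    and factor_trans: "\<And>i. i \<in> I \<Longrightarrow> \<exists>g\<in>S. conj_set P g (T b) = T i"
    and subgroup_A: "subgroup A P" and subgroup_B: "subgroup B P"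
    and A_sub: "A \<subseteq> T b" and B_sub: "B \<subseteq> T b" and A_proper: "A \<noteq> T b"
    and A_conj_B: "\<exists>g\<in>S. conj_set P g A = B"
    and A_mult_B: "A <#> B = T b"
    and A_int_B: "A \<inter> B = dproj (P\<lparr>carrier := M\<rparr>) I T b ` W"
    and stabilises_pair: "\<And>g. g \<in> S \<Longrightarrow>
          conj_set P g (T b) = T b \<longleftrightarrow> conj_set P g ` {A, B} = {A, B}"
    and \<phi>_one: "\<And>v. v \<in> V \<Longrightarrow> \<phi> \<one> v = v"
    and \<phi>_mult: "\<And>g h v. \<lbrakk>g \<in> S; h \<in> S; v \<in> V\<rbrakk> \<Longrightarrow> \<phi> (g \<otimes> h) v = \<phi> g (\<phi> h v)"
    and \<phi>_closed: "\<And>g v. \<lbrakk>g \<in> S; v \<in> V\<rbrakk> \<Longrightarrow> \<phi> g v \<in> V"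
    and \<phi>_trans: "\<And>v w. \<lbrakk>v \<in> V; w \<in> V\<rbrakk> \<Longrightarrow> \<exists>g\<in>S. \<phi> g v = w"
    and ends_conj: "\<And>g i. \<lbrakk>g \<in> S; i \<in> I\<rbrakk> \<Longrightarrow> ends (conj_set P g (T i)) = \<phi> g ` ends (T i)"
    and ends_b: "ends (T b) = {v\<^sub>1, v\<^sub>2}"
    and v\<^sub>1: "v\<^sub>1 \<in> V" and v\<^sub>2: "v\<^sub>2 \<in> V" and v\<^sub>1_neq_v\<^sub>2: "v\<^sub>1 \<noteq> v\<^sub>2"
    and fixes_pair: "\<And>g. \<lbrakk>g \<in> S; conj_set P g (T b) = T b\<rbrakk> \<Longrightarrow>
          conj_set P g A = A \<and> conj_set P g B = B \<longleftrightarrow> \<phi> g v\<^sub>1 = v\<^sub>1 \<and> \<phi> g v\<^sub>2 = v\<^sub>2"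
begin

sublocale M: internal_product "P\<lparr>carrier := M\<rparr>" I T
  unfolding internal_product_def internal_product_axioms_def
  using subgroup.subgroup_is_group[OF subgroup_M is_group] finite_I direct by blast

abbreviation \<pi> :: "'i \<Rightarrow> 'g \<Rightarrow> 'g" where
  "\<pi> \<equiv> dproj (P\<lparr>carrier := M\<rparr>) I T"

lemma M_carrier: "x \<in> M \<Longrightarrow> x \<in> carrier P"
  and S_carrier: "x \<in> S \<Longrightarrow> x \<in> carrier P"
  using subgroup_M subgroup_S subgroup.mem_carrier by metis+

lemma T_sub_M: "i \<in> I \<Longrightarrow> T i \<subseteq> M"
  using M.factor_carrier by auto

lemma T_carrier: "i \<in> I \<Longrightarrow> T i \<subseteq> carrier P"
  using T_sub_M M_carrier by blast

lemma subgroup_T: "i \<in> I \<Longrightarrow> subgroup (T i) P"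
  using M.factor_subgroup incl_subgroup[OF subgroup_M] by blast

lemma AB_carrier: "A \<subseteq> carrier P" "B \<subseteq> carrier P"
  using subgroup_A subgroup_B subgroup.subset by auto

lemma \<pi>_mem: "\<lbrakk>i \<in> I; x \<in> M\<rbrakk> \<Longrightarrow> \<pi> i x \<in> T i"
  using M.proj_mem by simp

lemma \<pi>_mult: "\<lbrakk>i \<in> I; x \<in> M; y \<in> M\<rbrakk> \<Longrightarrow> \<pi> i (x \<otimes> y) = \<pi> i x \<otimes> \<pi> i y"
  using M.proj_mult by simp

lemma \<pi>_inv: "\<lbrakk>i \<in> I; x \<in> M\<rbrakk> \<Longrightarrow> \<pi> i (inv x) = inv (\<pi> i x)"
  using M.proj_inv[of i x] m_inv_consistent[OF subgroup_M, of x]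
    m_inv_consistent[OF subgroup_M, of "\<pi> i x"] \<pi>_mem[of i x] T_sub_M[of i] by auto

text \<open>Projection to \<open>T i\<close> fixes a common element as a member of
  \<open>T i\<close> and kills it as a member of \<open>T j\<close>.\<close>

lemma T_inter: "\<lbrakk>i \<in> I; j \<in> I; i \<noteq> j\<rbrakk> \<Longrightarrow> T i \<inter> T j \<subseteq> {\<one>}"
  using M.proj_factor[of i] M.proj_other[of i j] by fastforce

lemma T_inj: "\<lbrakk>i \<in> I; j \<in> I; T i = T j\<rbrakk> \<Longrightarrow> i = j"
  using T_inter[of i j] factor_nontrivial[of i] subgroup.one_closed[OF subgroup_T, of i] by auto

lemma conj_hom_M:
  assumes "g \<in> S"
  shows "(\<lambda>x. g \<otimes> x \<otimes> inv g) \<in> hom (P\<lparr>carrier := M\<rparr>) (P\<lparr>carrier := M\<rparr>)"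
proof (rule homI)
  fix x y assume "x \<in> carrier (P\<lparr>carrier := M\<rparr>)" "y \<in> carrier (P\<lparr>carrier := M\<rparr>)"
  then have xy: "x \<in> carrier P" "y \<in> carrier P" using M_carrier by auto
  have g: "g \<in> carrier P" using assms S_carrier by blast
  have "inv g \<otimes> (g \<otimes> (y \<otimes> inv g)) = y \<otimes> inv g"
    using xy g by (simp add: m_assoc[symmetric])
  then show "g \<otimes> (x \<otimes>\<^bsub>P\<lparr>carrier := M\<rparr>\<^esub> y) \<otimes> inv g =
      (g \<otimes> x \<otimes> inv g) \<otimes>\<^bsub>P\<lparr>carrier := M\<rparr>\<^esub> (g \<otimes> y \<otimes> inv g)"
    using xy g by (simp add: m_assoc)
qed (use assms conj_M in simp)

text \<open>By \<open>T_inj\<close>, only \<open>T i\<close> is conjugated onto \<open>T j\<close>,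
  so \<open>proj_hom_swap\<close> applies to conjugation by \<open>g\<close>.\<close>

lemma \<pi>_conj:
  assumes g: "g \<in> S" and i: "i \<in> I" and j: "j \<in> I" and ij: "conj_set P g (T i) = T j"
    and x: "x \<in> M"
  shows "\<pi> j (g \<otimes> x \<otimes> inv g) = g \<otimes> \<pi> i x \<otimes> inv g"
proof -
  have "\<exists>m\<in>I. m \<noteq> j \<and> (\<lambda>x. g \<otimes> x \<otimes> inv g) ` T l \<subseteq> T m" if l: "l \<in> I" "l \<noteq> i" for l
  proof -
    obtain m where m: "m \<in> I" "conj_set P g (T l) = T m" using conj_factor g l by blast
    have "m \<noteq> j"
      using m(2) ij conj_set_cancel[of g "T l" "T i"] T_inj l i S_carrier[OF g] T_carrier by metis
    then show ?thesis using m unfolding conj_set_eq_image by auto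
  qed
  moreover have "(\<lambda>x. g \<otimes> x \<otimes> inv g) ` T i \<subseteq> T j" using ij unfolding conj_set_eq_image by auto
  ultimately show ?thesis
    using M.proj_hom_swap[OF conj_hom_M[OF g] i j] x by simp
qed

lemma conj_S_mult:
  "\<lbrakk>g \<in> S; h \<in> S; H \<subseteq> carrier P\<rbrakk> \<Longrightarrow> conj_set P (g \<otimes> h) H = conj_set P g (conj_set P h H)"
  using conj_set_mult S_carrier by blast

lemma S_inv: "g \<in> S \<Longrightarrow> inv g \<in> S" and S_mult: "g \<in> S \<Longrightarrow> h \<in> S \<Longrightarrow> g \<otimes> h \<in> S"
  using subgroup_S subgroup.m_inv_closed subgroup.m_closed by metis+

lemma \<phi>_inv_iff: "\<lbrakk>g \<in> S; v \<in> V; w \<in> V\<rbrakk> \<Longrightarrow> \<phi> (inv g) v = w \<longleftrightarrow> v = \<phi> g w"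
  using \<phi>_mult[of g "inv g" v] \<phi>_mult[of "inv g" g w] \<phi>_one S_inv[of g] S_carrier[of g] by auto

section \<open>Action of the stabiliser on the arcs of the graph\<close>

lemma A_neq_B: "A \<noteq> B"
  using A_mult_B A_proper set_mult_subgroup_idem[OF subgroup_A, of A]
    group.subgroup_self[OF subgroup.subgroup_is_group[OF subgroup_A is_group]]
  by auto

text \<open>Needed so that \<open>B\<close> determines the factor containing it, since distinct
  factors meet trivially.\<close>

lemma B_nontrivial: "B \<noteq> {\<one>}"
proof
  assume "B = {\<one>}"
  then have "A <#> B = A" using coset_mult_one[OF AB_carrier(1)] by (simp add: r_coset_eq_set_mult)
  then show False using A_mult_B A_proper by simp
qed

text \<open>Such an \<open>n\<close> permutes both \<open>{A, B}\<close> and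
  \<open>{v\<^sub>1, v\<^sub>2}\<close>, and by \<open>fixes_pair\<close> it fixes one pair
  pointwise exactly when it fixes the other. So both pairs are fixed or both are swapped.\<close>

lemma local_stabiliser:
  assumes n: "n \<in> S" and nT: "conj_set P n (T b) = T b"
  shows "\<phi> n v\<^sub>1 = v\<^sub>1 \<and> \<phi> n v\<^sub>2 = v\<^sub>2 \<and> conj_set P n A = A \<and> conj_set P n B = B \<or>
    \<phi> n v\<^sub>1 = v\<^sub>2 \<and> \<phi> n v\<^sub>2 = v\<^sub>1 \<and> conj_set P n A = B \<and> conj_set P n B = A"
proof -
  have "{conj_set P n A, conj_set P n B} = {A, B}" using stabilises_pair[OF n] nT by auto
  moreover have "{\<phi> n v\<^sub>1, \<phi> n v\<^sub>2} = {v\<^sub>1, v\<^sub>2}" using ends_conj[OF n b] nT ends_b by auto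
  ultimately show ?thesis
    using fixes_pair[OF n nT] A_neq_B v\<^sub>1_neq_v\<^sub>2 by (auto simp: doubleton_eq_iff)
qed

lemma ex_swap:
  "\<exists>s\<in>S. conj_set P s (T b) = T b \<and> \<phi> s v\<^sub>1 = v\<^sub>2 \<and> \<phi> s v\<^sub>2 = v\<^sub>1 \<and>
    conj_set P s A = B \<and> conj_set P s B = A"
proof -
  obtain s where s: "s \<in> S" "conj_set P s A = B" using A_conj_B by blast
  obtain j where j: "j \<in> I" "conj_set P s (T b) = T j" using conj_factor s b by blast
  \<comment> \<open>The factor to which \<open>s\<close> moves \<open>T b\<close> shares the
    nontrivial subgroup \<open>B\<close> with \<open>T b\<close>, so it is \<open>T b\<close>
    itself.\<close>
  have "B \<subseteq> T j" using s(2) j(2) A_sub unfolding conj_set_eq_image by blast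
  then have "j = b"
    using B_sub T_inter[OF b j(1)] B_nontrivial subgroup.one_closed[OF subgroup_B] by blast
  then have "conj_set P s (T b) = T b" using j by simp
  then show ?thesis using local_stabiliser[OF s(1)] s A_neq_B by metis
qed

text \<open>\<open>inv g \<otimes> h\<close> normalises \<open>T b\<close>, so it fixes or swaps
  both pairs. Hence the conjugate of \<open>A\<close> attached to an arc depends on the arc alone,
  not on the element that reaches it.\<close>

lemma same_factor:
  assumes g: "g \<in> S" and h: "h \<in> S" and eq: "conj_set P g (T b) = conj_set P h (T b)"
  shows "\<phi> h v\<^sub>1 = \<phi> g v\<^sub>1 \<and> conj_set P h A = conj_set P g A \<or>
    \<phi> h v\<^sub>1 = \<phi> g v\<^sub>2 \<and> conj_set P h A = conj_set P g B"
proof -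
  let ?n = "inv g \<otimes> h"
  have n: "?n \<in> S" using g h S_inv S_mult by blast
  have h_eq: "h = g \<otimes> ?n"
    using S_carrier g h by (simp add: m_assoc[symmetric])
  have "conj_set P ?n (T b) = conj_set P (inv g) (conj_set P g (T b))"
    using conj_S_mult[OF S_inv[OF g] h T_carrier[OF b]] eq by simp
  also have "\<dots> = T b"
    using conj_set_inv_iff[OF S_carrier[OF g] conj_set_closed T_carrier[OF b]]
      S_carrier[OF g] T_carrier[OF b] by simp
  finally have nT: "conj_set P ?n (T b) = T b" .
  have "\<phi> h v\<^sub>1 = \<phi> g (\<phi> ?n v\<^sub>1)" using h_eq \<phi>_mult[OF g n v\<^sub>1] by simp
  moreover have "conj_set P h A = conj_set P g (conj_set P ?n A)"
    using h_eq conj_S_mult[OF g n AB_carrier(1)] by simp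
  ultimately show ?thesis using local_stabiliser[OF n nT] by auto
qed

section \<open>Vertex subgroups: equivariance and projections to the factors\<close>

lemma neighbours_neq: "g \<in> S \<Longrightarrow> \<phi> g v\<^sub>1 \<noteq> \<phi> g v\<^sub>2"
  using \<phi>_inv_iff v\<^sub>1 v\<^sub>2 v\<^sub>1_neq_v\<^sub>2 \<phi>_closed by metis

lemma ends_factor: "\<lbrakk>g \<in> S; conj_set P g (T b) = T i\<rbrakk> \<Longrightarrow> ends (T i) = {\<phi> g v\<^sub>1, \<phi> g v\<^sub>2}"
  using ends_conj[of g b] b ends_b by auto

text \<open>Quantifying over every \<open>g\<close> that reaches an arc at \<open>v\<close> avoids
  choosing representatives; by \<open>same_factor\<close> the conditions for one arc coincide. For a
  factor not incident with \<open>v\<close> the condition is vacuous.\<close>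

definition K :: "'v \<Rightarrow> 'g set" where
  "K v = {x \<in> M. \<forall>i\<in>I. \<forall>g\<in>S. conj_set P g (T b) = T i \<and> \<phi> g v\<^sub>1 = v \<longrightarrow> \<pi> i x \<in> conj_set P g A}"

lemma K_sub_M: "K v \<subseteq> M"
  unfolding K_def by blast

lemma subgroup_K: "subgroup (K v) P"
proof (rule subgroupI)
  have A: "subgroup (conj_set P g A) P" if "g \<in> S" for g
    using conj_subgroup[OF subgroup_A S_carrier[OF that]] .
  show "K v \<subseteq> carrier P" using K_sub_M M_carrier by blast
  have "\<one> \<in> K v"
    unfolding K_def using subgroup.one_closed[OF subgroup_M] subgroup.one_closed[OF A]
      group_hom.hom_one[OF M.proj_group_hom] by auto
  then show "K v \<noteq> {}" by blast
  show "inv x \<in> K v" if "x \<in> K v" for x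
    using that subgroup.m_inv_closed[OF A] subgroup.m_inv_closed[OF subgroup_M]
    unfolding K_def by (auto simp: \<pi>_inv)
  show "x \<otimes> y \<in> K v" if "x \<in> K v" "y \<in> K v" for x y
    using that subgroup.m_closed[OF A] subgroup.m_closed[OF subgroup_M]
    unfolding K_def by (auto simp: \<pi>_mult)
qed

text \<open>An arc at \<open>\<phi> h v\<close> reached by \<open>g\<close> comes from the arc at
  \<open>v\<close> reached by \<open>inv h \<otimes> g\<close>, so conjugation by \<open>h\<close>
  matches the defining conditions.\<close>

lemma conj_K_sub:
  assumes h: "h \<in> S" and v: "v \<in> V"
  shows "conj_set P h (K v) \<subseteq> K (\<phi> h v)"
proof
  fix y assume "y \<in> conj_set P h (K v)"
  then obtain x where x: "x \<in> K v" and y: "y = h \<otimes> x \<otimes> inv h" unfolding conj_set_eq_image by auto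
  have xM: "x \<in> M" using x K_sub_M by blast
  have "\<pi> i y \<in> conj_set P g A"
    if i: "i \<in> I" and g: "g \<in> S" and gT: "conj_set P g (T b) = T i" and gv: "\<phi> g v\<^sub>1 = \<phi> h v" for i g
  proof -
    let ?g = "inv h \<otimes> g"
    have g': "?g \<in> S" using g h S_inv S_mult by blast
    have g_eq: "g = h \<otimes> ?g" using S_carrier g h by (simp add: m_assoc[symmetric])
    obtain j where j: "j \<in> I" "conj_set P ?g (T b) = T j" using conj_factor[OF g' b] by blast
    have "conj_set P h (T j) = T i"
      using conj_S_mult[OF h g' T_carrier[OF b]] g_eq gT j by simp
    then have "\<pi> i y = h \<otimes> \<pi> j x \<otimes> inv h" using \<pi>_conj[OF h j(1) i _ xM] y by simp
    moreover have "\<phi> ?g v\<^sub>1 = v"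
      using \<phi>_mult[OF S_inv[OF h] g v\<^sub>1] gv \<phi>_inv_iff[OF h \<phi>_closed[OF h v] v] by simp
    then have "\<pi> j x \<in> conj_set P ?g A" using x j g' unfolding K_def by blast
    ultimately have "\<pi> i y \<in> conj_set P h (conj_set P ?g A)" unfolding conj_set_eq_image by blast
    then show ?thesis using conj_S_mult[OF h g' AB_carrier(1)] g_eq by simp
  qed
  moreover have "y \<in> M" using y conj_M[OF h xM] by simp
  ultimately show "y \<in> K (\<phi> h v)" unfolding K_def by blast
qed

text \<open>The reverse inclusion is \<open>conj_K_sub\<close> for \<open>inv h\<close>. This
  equivariance later makes the decomposition invariant under the point stabiliser.\<close>

lemma K_conj:
  assumes h: "h \<in> S" and v: "v \<in> V"
  shows "K (\<phi> h v) = conj_set P h (K v)"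
proof
  have Kc: "K w \<subseteq> carrier P" for w using subgroup.subset[OF subgroup_K] .
  have hc: "h \<in> carrier P" "inv h \<in> carrier P" using S_carrier[OF h] by auto
  have "conj_set P (inv h) (K (\<phi> h v)) \<subseteq> K v"
    using conj_K_sub[OF S_inv[OF h] \<phi>_closed[OF h v]] \<phi>_inv_iff[OF h \<phi>_closed[OF h v] v] by simp
  then have "conj_set P h (conj_set P (inv h) (K (\<phi> h v))) \<subseteq> conj_set P h (K v)"
    unfolding conj_set_eq_image by blast
  then show "K (\<phi> h v) \<subseteq> conj_set P h (K v)"
    using conj_set_mult[OF hc Kc] conj_set_one[OF Kc] hc by simp
qed (rule conj_K_sub[OF h v])

text \<open>For the inclusion from right to left, an element of the conjugate of \<open>A\<close>
  inside \<open>T i\<close> already lies in \<open>K (\<phi> g v\<^sub>1)\<close>: its components in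
  other factors are trivial.\<close>

lemma proj_K_first:
  assumes g: "g \<in> S" and i: "i \<in> I" and gT: "conj_set P g (T b) = T i"
  shows "\<pi> i ` K (\<phi> g v\<^sub>1) = conj_set P g A"
proof
  show "\<pi> i ` K (\<phi> g v\<^sub>1) \<subseteq> conj_set P g A" using g i gT unfolding K_def by blast
  show "conj_set P g A \<subseteq> \<pi> i ` K (\<phi> g v\<^sub>1)"
  proof
    fix x assume x: "x \<in> conj_set P g A"
    have xT: "x \<in> T i" using x A_sub gT unfolding conj_set_eq_image by blast
    have "\<pi> j x \<in> conj_set P h A"
      if j: "j \<in> I" and h: "h \<in> S" and hT: "conj_set P h (T b) = T j" and hv: "\<phi> h v\<^sub>1 = \<phi> g v\<^sub>1" for j h
    proof (cases "j = i")
      case True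
      \<comment> \<open>The alternative with \<open>B\<close> in \<open>same_factor\<close> would
        make the two ends of \<open>T i\<close> equal.\<close>
      then have "conj_set P h A = conj_set P g A"
        using same_factor[OF g h] gT hT hv neighbours_neq[OF g] by auto
      then show ?thesis using True x xT M.proj_factor[OF i] by simp
    next
      case False
      then have "\<pi> j x = \<one>" using M.proj_other[OF j i _ xT] by simp
      then show ?thesis
        using subgroup.one_closed[OF conj_subgroup[OF subgroup_A S_carrier[OF h]]] by simp
    qed
    then have "x \<in> K (\<phi> g v\<^sub>1)" using xT T_sub_M[OF i] unfolding K_def by blast
    moreover have "\<pi> i x = x" using M.proj_factor[OF i xT] .
    ultimately show "x \<in> \<pi> i ` K (\<phi> g v\<^sub>1)" by (metis imageI)
  qed
qed

text \<open>Composing \<open>g\<close> with the swap of the base edge turns the second end into a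
  first end.\<close>

lemma proj_K_second:
  assumes g: "g \<in> S" and i: "i \<in> I" and gT: "conj_set P g (T b) = T i"
  shows "\<pi> i ` K (\<phi> g v\<^sub>2) = conj_set P g B"
proof -
  obtain s where s: "s \<in> S" "conj_set P s (T b) = T b" "\<phi> s v\<^sub>1 = v\<^sub>2" "conj_set P s A = B"
    using ex_swap by blast
  have "conj_set P (g \<otimes> s) (T b) = T i" using conj_S_mult[OF g s(1) T_carrier[OF b]] s gT by simp
  then have "\<pi> i ` K (\<phi> (g \<otimes> s) v\<^sub>1) = conj_set P (g \<otimes> s) A"
    using proj_K_first[OF S_mult[OF g s(1)] i] by blast
  then show ?thesis using \<phi>_mult[OF g s(1) v\<^sub>1] conj_S_mult[OF g s(1) AB_carrier(1)] s by simp
qed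

text \<open>No arc at \<open>v\<close> uses \<open>T i\<close>, so the whole of \<open>T i\<close>
  is contained in \<open>K v\<close>.\<close>

lemma proj_K_other:
  assumes i: "i \<in> I" and v: "v \<notin> ends (T i)"
  shows "\<pi> i ` K v = T i"
proof
  show "\<pi> i ` K v \<subseteq> T i" using \<pi>_mem[OF i] K_sub_M by blast
  show "T i \<subseteq> \<pi> i ` K v"
  proof
    fix x assume x: "x \<in> T i"
    have "\<pi> j x \<in> conj_set P h A"
      if j: "j \<in> I" and h: "h \<in> S" and hT: "conj_set P h (T b) = T j" and hv: "\<phi> h v\<^sub>1 = v" for j h
    proof -
      have "j \<noteq> i" using ends_factor[OF h hT] hv v by auto
      then have "\<pi> j x = \<one>" using M.proj_other[OF j i _ x] by simp
      then show ?thesis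
        using subgroup.one_closed[OF conj_subgroup[OF subgroup_A S_carrier[OF h]]] by simp
    qed
    then have "x \<in> K v" using x T_sub_M[OF i] unfolding K_def by blast
    moreover have "\<pi> i x = x" using M.proj_factor[OF i x] .
    ultimately show "x \<in> \<pi> i ` K v" by (metis imageI)
  qed
qed

lemma conj_proper:
  assumes g: "g \<in> S" and gT: "conj_set P g (T b) = T i"
  shows "conj_set P g A \<noteq> T i" "conj_set P g B \<noteq> T i"
proof -
  \<comment> \<open>The swap takes \<open>B\<close> to \<open>A\<close> and \<open>T b\<close> to
    itself, so \<open>B\<close> inherits properness from \<open>A\<close>.\<close>
  have "B \<noteq> T b"
    using ex_swap conj_set_cancel[OF S_carrier AB_carrier(2) T_carrier[OF b]] A_proper by metis
  then show "conj_set P g A \<noteq> T i" "conj_set P g B \<noteq> T i"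
    using conj_set_cancel[OF S_carrier[OF g] _ T_carrier[OF b]] AB_carrier A_proper gT by metis+
qed

lemma proj_K_proper_iff:
  assumes i: "i \<in> I"
  shows "\<pi> i ` K v \<noteq> T i \<longleftrightarrow> v \<in> ends (T i)"
proof -
  obtain g where g: "g \<in> S" "conj_set P g (T b) = T i" using factor_trans[OF i] by blast
  show ?thesis
    using proj_K_other[OF i] ends_factor[OF g] proj_K_first[OF g(1) i g(2)]
      proj_K_second[OF g(1) i g(2)] conj_proper[OF g] by auto
qed

text \<open>
  The factorisation \<open>A B = T\<^sub>b\<close> is what makes the two conditions at the ends of an edge
  simultaneously solvable in the corresponding factor.
\<close>

lemma ex_common_coset_element:
  assumes x: "\<And>v. v \<in> V \<Longrightarrow> x v \<in> M"
  shows "\<exists>y\<in>M. \<forall>v\<in>V. inv (x v) \<otimes> y \<in> K v"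
proof -
  \<comment> \<open>The problem is solved in each factor separately: \<open>t\<close> is the future
    component of \<open>y\<close> and must meet the conditions from both ends of the edge
    \<open>T i\<close>.\<close>
  have "\<exists>t. t \<in> T i \<and> (\<forall>g\<in>S. conj_set P g (T b) = T i \<longrightarrow>
      inv (\<pi> i (x (\<phi> g v\<^sub>1))) \<otimes> t \<in> conj_set P g A)" if i: "i \<in> I" for i
  proof -
    obtain g where g: "g \<in> S" and gT: "conj_set P g (T b) = T i" using factor_trans[OF i] by blast
    have gc: "g \<in> carrier P" using S_carrier[OF g] .
    define p q where "p = \<pi> i (x (\<phi> g v\<^sub>1))" and "q = \<pi> i (x (\<phi> g v\<^sub>2))"
    have pq: "p \<in> T i" "q \<in> T i"
      unfolding p_def q_def using \<pi>_mem[OF i] x \<phi>_closed[OF g] v\<^sub>1 v\<^sub>2 by auto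
    then have pqc: "p \<in> carrier P" "q \<in> carrier P" using T_carrier[OF i] by auto
    \<comment> \<open>The left cosets through \<open>p\<close> and \<open>q\<close> of the
      conjugates of \<open>A\<close> and \<open>B\<close> meet exactly when
      \<open>inv p \<otimes> q\<close> lies in the product of these conjugates, which is all of
      \<open>T i\<close>.\<close>
    have "inv p \<otimes> q \<in> conj_set P g (A <#> B)"
      using pq subgroup_T[OF i] A_mult_B gT by (simp add: subgroup.m_closed subgroup.m_inv_closed)
    then obtain a c where a: "a \<in> A" and c: "c \<in> B" and ac: "inv p \<otimes> q = g \<otimes> (a \<otimes> c) \<otimes> inv g"
      unfolding conj_set_eq_image set_mult_def by auto
    have carr: "a \<in> carrier P" "c \<in> carrier P" using a c AB_carrier by auto
    define a' c' where "a' = g \<otimes> a \<otimes> inv g" and "c' = g \<otimes> c \<otimes> inv g"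
    have a': "a' \<in> conj_set P g A" and c': "c' \<in> conj_set P g B"
      unfolding a'_def c'_def conj_set_eq_image using a c by auto
    have carr': "a' \<in> carrier P" "c' \<in> carrier P" unfolding a'_def c'_def using carr gc by auto
    have "inv g \<otimes> (g \<otimes> (c \<otimes> inv g)) = c \<otimes> inv g"
      using carr gc by (simp add: m_assoc[symmetric])
    then have "inv p \<otimes> q = a' \<otimes> c'"
      unfolding a'_def c'_def using ac carr gc by (simp add: m_assoc)
    then have "q = p \<otimes> a' \<otimes> c'" using pqc carr' inv_solve_left' m_assoc m_closed by metis
    \<comment> \<open>This common value lies in both cosets and is the witness for
      \<open>T i\<close>.\<close>
    then have qp: "p \<otimes> a' = q \<otimes> inv c'" using pqc carr' by (metis inv_solve_right m_closed)
    have a'T: "a' \<in> T i" using a A_sub gT unfolding a'_def conj_set_eq_image by blast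
    have "inv (\<pi> i (x (\<phi> h v\<^sub>1))) \<otimes> (p \<otimes> a') \<in> conj_set P h A"
      if h: "h \<in> S" and hT: "conj_set P h (T b) = T i" for h
    proof -
      consider "\<phi> h v\<^sub>1 = \<phi> g v\<^sub>1" "conj_set P h A = conj_set P g A"
        | "\<phi> h v\<^sub>1 = \<phi> g v\<^sub>2" "conj_set P h A = conj_set P g B"
        using same_factor[OF g h] gT hT by auto
      then show ?thesis
      proof cases
        case 1
        then show ?thesis
          using pqc carr' a' by (simp add: m_assoc[symmetric] p_def[symmetric])
      next
        case 2
        then have "inv (\<pi> i (x (\<phi> h v\<^sub>1))) \<otimes> (p \<otimes> a') = inv c'"
          using pqc carr' qp by (simp add: m_assoc[symmetric] q_def[symmetric])
        then show ?thesis
          using 2 subgroup.m_inv_closed[OF conj_subgroup[OF subgroup_B gc] c'] by simp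
      qed
    qed
    moreover have "p \<otimes> a' \<in> T i" using pq a'T subgroup.m_closed[OF subgroup_T[OF i]] by blast
    ultimately show ?thesis by blast
  qed
  then obtain t where t: "\<And>i. i \<in> I \<Longrightarrow> t i \<in> T i"
    and tA: "\<And>i g. \<lbrakk>i \<in> I; g \<in> S; conj_set P g (T b) = T i\<rbrakk> \<Longrightarrow>
      inv (\<pi> i (x (\<phi> g v\<^sub>1))) \<otimes> t i \<in> conj_set P g A"
    by metis
  obtain y where y: "y \<in> M" "\<And>i. i \<in> I \<Longrightarrow> \<pi> i y = t i"
    using M.ex_proj[of t] t by auto
  have "inv (x v) \<otimes> y \<in> K v" if v: "v \<in> V" for v
  proof -
    have xi: "inv (x v) \<in> M" using x[OF v] subgroup.m_inv_closed[OF subgroup_M] by blast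
    have "\<pi> i (inv (x v) \<otimes> y) \<in> conj_set P g A"
      if "i \<in> I" "g \<in> S" "conj_set P g (T b) = T i" "\<phi> g v\<^sub>1 = v" for i g
      using tA[OF that(1,2,3)] that(4) y xi x[OF v] that(1) by (simp add: \<pi>_mult \<pi>_inv)
    then show ?thesis
      using xi y subgroup.m_closed[OF subgroup_M] unfolding K_def by blast
  qed
  then show ?thesis using y by blast
qed

section \<open>Intersection, properness and distinctness of the vertex subgroups\<close>

lemma Inter_K: "(\<Inter>v\<in>V. K v) = W"
proof
  \<comment> \<open>The description of \<open>A \<inter> B\<close> is carried from
    \<open>T b\<close> to every factor by conjugation, \<open>W\<close> being invariant under
    \<open>S\<close>.\<close>
  have fixed: "conj_set P g A \<inter> conj_set P g B = \<pi> i ` W"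
    if g: "g \<in> S" and i: "i \<in> I" and gT: "conj_set P g (T b) = T i" for g i
  proof -
    have gc: "g \<in> carrier P" using S_carrier[OF g] .
    have "conj_set P g W = W"
      using conj_set_eq_self[OF subgroup_S g subgroup.subset[OF subgroup_W]] conj_W
      unfolding conj_set_eq_image by blast
    then have "\<pi> i ` W = \<pi> i ` (\<lambda>x. g \<otimes> x \<otimes> inv g) ` W" unfolding conj_set_eq_image by simp
    also have "\<dots> = conj_set P g (\<pi> b ` W)"
      unfolding conj_set_eq_image image_image
      by (rule image_cong[OF refl]) (use \<pi>_conj[OF g b i gT] W_sub_M in blast)
    also have "\<dots> = conj_set P g A \<inter> conj_set P g B"
      unfolding A_int_B[symmetric] conj_set_eq_image
      by (rule inj_on_image_Int[OF conj_inj[OF gc] AB_carrier])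
    finally show ?thesis by simp
  qed
  show "W \<subseteq> (\<Inter>v\<in>V. K v)"
    using fixed W_sub_M unfolding K_def by blast
  show "(\<Inter>v\<in>V. K v) \<subseteq> W"
  proof
    fix x assume x: "x \<in> (\<Inter>v\<in>V. K v)"
    have xM: "x \<in> M" using x v\<^sub>1 K_sub_M by blast
    \<comment> \<open>By \<open>proj_W\<close> the projections of \<open>W\<close> lie in
      \<open>W\<close>, so all components of \<open>x\<close> do, and \<open>x\<close> is recovered
      from them inside \<open>W\<close>.\<close>
    have "\<pi> i x \<in> W" if i: "i \<in> I" for i
    proof -
      obtain g where g: "g \<in> S" and gT: "conj_set P g (T b) = T i" using factor_trans[OF i] by blast
      have "x \<in> K (\<phi> g v\<^sub>1)" "x \<in> K (\<phi> g v\<^sub>2)"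
        using x \<phi>_closed[OF g v\<^sub>1] \<phi>_closed[OF g v\<^sub>2] by auto
      then have "\<pi> i x \<in> conj_set P g A \<inter> conj_set P g B"
        using imageI[of x "K (\<phi> g v\<^sub>1)" "\<pi> i"] imageI[of x "K (\<phi> g v\<^sub>2)" "\<pi> i"]
        unfolding proj_K_first[OF g i gT] proj_K_second[OF g i gT] by blast
      then show ?thesis using fixed[OF g i gT] proj_W[OF i] by blast
    qed
    then show "x \<in> W"
      using M.mem_subgroupI[of W x] xM subgroup_incl[OF subgroup_W subgroup_M W_sub_M] by simp
  qed
qed

lemma ex_arc:
  assumes "v \<in> V"
  shows "\<exists>g\<in>S. \<exists>i\<in>I. \<phi> g v\<^sub>1 = v \<and> conj_set P g (T b) = T i"
  using \<phi>_trans[OF v\<^sub>1 assms] conj_factor b by blast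

text \<open>Otherwise \<open>K v\<close> would project onto the factor of an arc at
  \<open>v\<close>, where its projection is a proper conjugate of \<open>A\<close>.\<close>

lemma K_neq_M:
  assumes v: "v \<in> V"
  shows "K v \<noteq> M"
proof
  assume eq: "K v = M"
  obtain g i where g: "g \<in> S" "i \<in> I" "\<phi> g v\<^sub>1 = v" "conj_set P g (T b) = T i"
    using ex_arc[OF v] by blast
  have "T i \<subseteq> \<pi> i ` M"
  proof
    fix t assume "t \<in> T i"
    then have "t = \<pi> i t" "t \<in> M" using M.proj_factor[OF g(2)] T_sub_M[OF g(2)] by auto
    then show "t \<in> \<pi> i ` M" by (rule image_eqI)
  qed
  then have "\<pi> i ` K v = T i" using eq \<pi>_mem[OF g(2)] by blast
  then show False using proj_K_first[OF g(1,2,4)] g(3) conj_proper(1)[OF g(1,4)] by simp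
qed

text \<open>If \<open>K v = K w\<close>, a common coset element for the family that is an arbitrary
  \<open>m\<close> at \<open>w\<close> and the identity elsewhere puts \<open>m\<close> into
  \<open>K v\<close>, forcing \<open>K v = M\<close>.\<close>

lemma K_inj: "inj_on K V"
proof (rule inj_onI, rule ccontr)
  fix v w assume v: "v \<in> V" and w: "w \<in> V" and eq: "K v = K w" and neq: "v \<noteq> w"
  have "m \<in> K v" if m: "m \<in> M" for m
  proof -
    have "\<exists>y\<in>M. \<forall>u\<in>V. inv (if u = w then m else \<one>) \<otimes> y \<in> K u"
      by (rule ex_common_coset_element) (use m subgroup.one_closed[OF subgroup_M] in simp)
    then obtain y where y: "y \<in> M" "\<forall>u\<in>V. inv (if u = w then m else \<one>) \<otimes> y \<in> K u" by blast
    have carr: "y \<in> carrier P" "m \<in> carrier P" using y m M_carrier by auto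
    have yv: "y \<in> K v" using y(2)[rule_format, OF v] neq carr by simp
    have "inv m \<otimes> y \<in> K v" using y(2)[rule_format, OF w] eq by simp
    then have "y \<otimes> inv (inv m \<otimes> y) \<in> K v"
      using yv subgroup_K by (simp add: subgroup.m_closed subgroup.m_inv_closed)
    then show ?thesis using carr by (simp add: inv_mult_group m_assoc[symmetric])
  qed
  then show False using K_neq_M[OF v] K_sub_M by blast
qed

lemma conj_set_M: "g \<in> S \<Longrightarrow> conj_set P g M = M"
  using conj_set_eq_self[OF subgroup_S _ subgroup.subset[OF subgroup_M]] conj_M
  unfolding conj_set_eq_image by blast

section \<open>The vertex subgroups that project properly to a given factor\<close>

lemma ends_sub_V:
  assumes "i \<in> I"
  shows "ends (T i) \<subseteq> V"
proof -
  obtain g where g: "g \<in> S" "conj_set P g (T b) = T i" using factor_trans[OF assms] by blast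
  show ?thesis unfolding ends_factor[OF g] using \<phi>_closed[OF g(1)] v\<^sub>1 v\<^sub>2 by simp
qed

text \<open>This identifies the ends of the edge \<open>T i\<close> in the graph of the
  decomposition with the images under \<open>K\<close> of its ends in the given graph.\<close>

lemma properly_projecting_subgroups:
  assumes i: "i \<in> I"
  shows "{L \<in> K ` V. \<pi> i ` L \<noteq> T i} = K ` ends (T i)"
proof -
  have "{L \<in> K ` V. \<pi> i ` L \<noteq> T i} = K ` {v \<in> V. \<pi> i ` K v \<noteq> T i}" by blast
  also have "{v \<in> V. \<pi> i ` K v \<noteq> T i} = ends (T i)"
    unfolding proj_K_proper_iff[OF i] using ends_sub_V[OF i] by blast
  finally show ?thesis .
qed

lemma proper_projections:
  assumes g: "g \<in> S" and i: "i \<in> I" and gT: "conj_set P g (T b) = T i"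
  shows "{\<pi> i ` L | L. L \<in> K ` V \<and> \<pi> i ` L \<noteq> T i} = {conj_set P g A, conj_set P g B}"
proof -
  have "{\<pi> i ` L | L. L \<in> K ` V \<and> \<pi> i ` L \<noteq> T i} = (\<lambda>L. \<pi> i ` L) ` {L \<in> K ` V. \<pi> i ` L \<noteq> T i}"
    by blast
  then show ?thesis
    using properly_projecting_subgroups[OF i] ends_factor[OF g gT] proj_K_first[OF g i gT] proj_K_second[OF g i gT] by simp
qed

lemma conj_A_neq_conj_B: "g \<in> S \<Longrightarrow> conj_set P g A \<noteq> conj_set P g B"
  using conj_set_cancel[OF S_carrier AB_carrier] A_neq_B by blast

text \<open>Both subgroups are conjugates of \<open>A\<close> under \<open>S\<close>, because
  \<open>B\<close> is one.\<close>

lemma conj_A_conj: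
  assumes "g \<in> S" "C \<in> {conj_set P g A, conj_set P g B}" "D \<in> {conj_set P g A, conj_set P g B}"
  shows "\<exists>h\<in>S. conj_set P h C = D"
proof -
  obtain s where s: "s \<in> S" "conj_set P s A = B" using A_conj_B by blast
  have ex: "\<exists>x\<in>S. Z = conj_set P x A" if "Z \<in> {conj_set P g A, conj_set P g B}" for Z
    using that assms(1) s S_mult conj_S_mult[OF assms(1) s(1) AB_carrier(1)] by fastforce
  obtain x y where x: "x \<in> S" "C = conj_set P x A" and y: "y \<in> S" "D = conj_set P y A"
    using ex assms by metis
  have c: "x \<in> carrier P" "y \<in> carrier P" using x y S_carrier by auto
  have "conj_set P (y \<otimes> inv x) C = conj_set P (y \<otimes> inv x \<otimes> x) A"
    using conj_set_mult[of "y \<otimes> inv x" x A] c AB_carrier x by simp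
  also have "\<dots> = D" using c y by (simp add: m_assoc)
  finally show ?thesis using S_mult S_inv x y by blast
qed

end

subsection \<open>Coset partitions of a transitive permutation group\<close>

lemma BijGroup_group_action: "group_action (BijGroup \<Omega>) \<Omega> (\<lambda>g. g)"
proof -
  interpret group "BijGroup \<Omega>" by (rule group_BijGroup)
  show ?thesis by unfold_locales (simp add: hom_def)
qed

lemma mem_point_stab_iff: "g \<in> point_stab \<Omega> G \<omega> \<longleftrightarrow> g \<in> G \<and> g \<omega> = \<omega>"
  unfolding point_stab_def stabilizer_def by simp

lemma mem_set_stab_iff: "g \<in> set_stab \<Omega> G \<gamma> \<longleftrightarrow> g \<in> G \<and> g ` \<gamma> = \<gamma>"
  unfolding set_stab_def stabilizer_def by simp

locale transitive_perm_group =
  fixes \<Omega> :: "'a set" and M :: "('a \<Rightarrow> 'a) set" and \<omega> :: 'a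
  assumes subgroup_M: "subgroup M (BijGroup \<Omega>)"
    and base: "\<omega> \<in> \<Omega>"
    and trans: "\<And>z. z \<in> \<Omega> \<Longrightarrow> \<exists>m\<in>M. m \<omega> = z"
begin

abbreviation P :: "('a \<Rightarrow> 'a) monoid" where "P \<equiv> BijGroup \<Omega>"

sublocale group P by (rule group_BijGroup)

sublocale act: group_action P \<Omega> "\<lambda>g. g" by (rule BijGroup_group_action)

lemma M_carrier: "m \<in> M \<Longrightarrow> m \<in> carrier P"
  using subgroup_M subgroup.mem_carrier by metis

lemma M_inv: "m \<in> M \<Longrightarrow> inv\<^bsub>P\<^esub> m \<in> M"
  and M_mult: "m \<in> M \<Longrightarrow> n \<in> M \<Longrightarrow> m \<otimes>\<^bsub>P\<^esub> n \<in> M"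
  using subgroup_M by (simp_all add: subgroup.m_inv_closed subgroup.m_closed)

lemma mult_apply: "\<lbrakk>g \<in> carrier P; h \<in> carrier P; z \<in> \<Omega>\<rbrakk> \<Longrightarrow> (g \<otimes>\<^bsub>P\<^esub> h) z = g (h z)"
  using act.composition_rule by simp

lemma apply_closed: "\<lbrakk>g \<in> carrier P; z \<in> \<Omega>\<rbrakk> \<Longrightarrow> g z \<in> \<Omega>"
  using act.element_image by blast

lemma inv_apply: "\<lbrakk>g \<in> carrier P; z \<in> \<Omega>\<rbrakk> \<Longrightarrow> (inv\<^bsub>P\<^esub> g) (g z) = z"
  using act.orbit_sym_aux by blast

lemma one_apply: "z \<in> \<Omega> \<Longrightarrow> \<one>\<^bsub>P\<^esub> z = z"
  using act.id_eq_one by (metis restrict_apply')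

text \<open>The image of the base point under the left coset \<open>x K\<close>. For
  \<open>K\<close> between the point stabiliser and \<open>M\<close>, these sets form an
  \<open>M\<close>-invariant partition of \<open>\<Omega>\<close>.\<close>

definition block :: "('a \<Rightarrow> 'a) set \<Rightarrow> ('a \<Rightarrow> 'a) \<Rightarrow> 'a set" where
  "block K x = (\<lambda>h. x (h \<omega>)) ` K"

definition blocks :: "('a \<Rightarrow> 'a) set \<Rightarrow> 'a set set" where
  "blocks K = block K ` M"

text \<open>The dictionary between points and cosets: since \<open>K\<close> contains the point
  stabiliser, an equality of points can be read as a relation between group elements modulo
  \<open>K\<close>.\<close>

lemma mem_block_iff:
  assumes K: "subgroup K P" "K \<subseteq> M" "point_stab \<Omega> M \<omega> \<subseteq> K" and x: "x \<in> M" and y: "y \<in> M"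
  shows "y \<omega> \<in> block K x \<longleftrightarrow> inv\<^bsub>P\<^esub> x \<otimes>\<^bsub>P\<^esub> y \<in> K"
proof
  have xy: "x \<in> carrier P" "y \<in> carrier P" using x y M_carrier by auto
  show "inv\<^bsub>P\<^esub> x \<otimes>\<^bsub>P\<^esub> y \<in> K" if mem: "y \<omega> \<in> block K x"
  proof -
    obtain h where h: "h \<in> K" "y \<omega> = x (h \<omega>)" using mem unfolding block_def by blast
    have hc: "h \<in> M" "h \<in> carrier P" using h K M_carrier by auto
    \<comment> \<open>The discrepancy between \<open>y\<close> and \<open>x \<otimes> h\<close>; it
      fixes \<open>\<omega>\<close> and hence lies in \<open>K\<close>.\<close>
    let ?k = "inv\<^bsub>P\<^esub> (x \<otimes>\<^bsub>P\<^esub> h) \<otimes>\<^bsub>P\<^esub> y"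
    have "?k \<omega> = \<omega>"
      using xy hc h(2) base inv_apply[of "x \<otimes>\<^bsub>P\<^esub> h" \<omega>] by (simp add: mult_apply)
    then have "?k \<in> K" using K(3) x y hc M_mult M_inv by (auto simp: mem_point_stab_iff)
    then have "h \<otimes>\<^bsub>P\<^esub> ?k \<in> K" using subgroup.m_closed[OF K(1) h(1)] by blast
    then show ?thesis using xy hc by (simp add: inv_mult_group m_assoc[symmetric])
  qed
  show "y \<omega> \<in> block K x" if k: "inv\<^bsub>P\<^esub> x \<otimes>\<^bsub>P\<^esub> y \<in> K"
  proof -
    have "x ((inv\<^bsub>P\<^esub> x \<otimes>\<^bsub>P\<^esub> y) \<omega>) = (x \<otimes>\<^bsub>P\<^esub> (inv\<^bsub>P\<^esub> x \<otimes>\<^bsub>P\<^esub> y)) \<omega>"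
      using xy base by (simp add: mult_apply)
    also have "\<dots> = y \<omega>" using xy by (simp add: m_assoc[symmetric])
    finally show ?thesis using k unfolding block_def by (metis (no_types, lifting) imageI)
  qed
qed

lemma block_sub: "\<lbrakk>x \<in> carrier P; K \<subseteq> carrier P\<rbrakk> \<Longrightarrow> block K x \<subseteq> \<Omega>"
  unfolding block_def using apply_closed base by blast

lemma block_eq:
  assumes K: "subgroup K P" "K \<subseteq> M" "point_stab \<Omega> M \<omega> \<subseteq> K" and x: "x \<in> M"
  shows "block K x = {y \<omega> | y. y \<in> M \<and> inv\<^bsub>P\<^esub> x \<otimes>\<^bsub>P\<^esub> y \<in> K}"
proof -
  have "block K x \<subseteq> \<Omega>" using block_sub M_carrier x K(2) by blast
  then show ?thesis using mem_block_iff[OF K x] trans by blast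
qed

lemma block_eqI:
  assumes K: "subgroup K P" "K \<subseteq> M" "point_stab \<Omega> M \<omega> \<subseteq> K" and x: "x \<in> M" "z \<in> M"
    and xz: "inv\<^bsub>P\<^esub> x \<otimes>\<^bsub>P\<^esub> z \<in> K"
  shows "block K x = block K z"
proof -
  have c: "x \<in> carrier P" "z \<in> carrier P" using x M_carrier by auto
  have zx: "inv\<^bsub>P\<^esub> z \<otimes>\<^bsub>P\<^esub> x \<in> K"
    using subgroup.m_inv_closed[OF K(1) xz] c by (simp add: inv_mult_group)
  have "inv\<^bsub>P\<^esub> x \<otimes>\<^bsub>P\<^esub> y \<in> K \<longleftrightarrow> inv\<^bsub>P\<^esub> z \<otimes>\<^bsub>P\<^esub> y \<in> K" if "y \<in> M" for y
  proof -
    have y: "y \<in> carrier P" using that M_carrier by blast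
    have "z \<otimes>\<^bsub>P\<^esub> (inv\<^bsub>P\<^esub> z \<otimes>\<^bsub>P\<^esub> y) = y" "x \<otimes>\<^bsub>P\<^esub> (inv\<^bsub>P\<^esub> x \<otimes>\<^bsub>P\<^esub> y) = y"
      using c y by (simp_all add: m_assoc[symmetric])
    then have "inv\<^bsub>P\<^esub> x \<otimes>\<^bsub>P\<^esub> y = (inv\<^bsub>P\<^esub> x \<otimes>\<^bsub>P\<^esub> z) \<otimes>\<^bsub>P\<^esub> (inv\<^bsub>P\<^esub> z \<otimes>\<^bsub>P\<^esub> y)"
      "inv\<^bsub>P\<^esub> z \<otimes>\<^bsub>P\<^esub> y = (inv\<^bsub>P\<^esub> z \<otimes>\<^bsub>P\<^esub> x) \<otimes>\<^bsub>P\<^esub> (inv\<^bsub>P\<^esub> x \<otimes>\<^bsub>P\<^esub> y)"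
      using c y by (simp_all add: m_assoc)
    then show ?thesis using subgroup.m_closed[OF K(1)] xz zx by metis
  qed
  then show ?thesis using block_eq[OF K x(1)] block_eq[OF K x(2)] by blast
qed

lemma self_mem_block:
  assumes "subgroup K P" "x \<in> carrier P"
  shows "x \<omega> \<in> block K x"
  unfolding block_def
  by (rule image_eqI[OF _ subgroup.one_closed[OF assms(1)]]) (simp add: one_apply[OF base])

lemma partition_blocks:
  assumes K: "subgroup K P" "K \<subseteq> M" "point_stab \<Omega> M \<omega> \<subseteq> K"
  shows "partition_on \<Omega> (blocks K)"
proof (rule partition_onI)
  show "\<Union> (blocks K) = \<Omega>"
  proof
    show "\<Union> (blocks K) \<subseteq> \<Omega>"
      unfolding blocks_def using block_sub M_carrier K(2) by blast
    show "\<Omega> \<subseteq> \<Union> (blocks K)"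
      unfolding blocks_def using trans self_mem_block[OF K(1) M_carrier] by blast
  qed
  show "disjnt p q" if pq: "p \<in> blocks K" "q \<in> blocks K" "p \<noteq> q" for p q
  proof (rule ccontr)
    assume "\<not> disjnt p q"
    then obtain u where u: "u \<in> p" "u \<in> q" unfolding disjnt_def by blast
    obtain x z where xz: "x \<in> M" "z \<in> M" "p = block K x" "q = block K z"
      using pq unfolding blocks_def by blast
    have "u \<in> \<Omega>" using u xz block_sub[of x K] M_carrier K(2) by blast
    then obtain y where y: "y \<in> M" "u = y \<omega>" using trans by metis
    have "inv\<^bsub>P\<^esub> x \<otimes>\<^bsub>P\<^esub> y \<in> K" "inv\<^bsub>P\<^esub> z \<otimes>\<^bsub>P\<^esub> y \<in> K"
      using u xz y mem_block_iff[OF K] by auto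
    then have "block K x = block K y" "block K z = block K y"
      using block_eqI[OF K] xz y by auto
    then show False using pq xz by simp
  qed
  show "{} \<notin> blocks K"
    unfolding blocks_def block_def using subgroup.one_closed[OF K(1)] by blast
qed

text \<open>With a single block, every \<open>y \<omega>\<close> lies in the block of the identity,
  and \<open>mem_block_iff\<close> puts all of \<open>M\<close> into \<open>K\<close>.\<close>

lemma proper_partition_blocks:
  assumes K: "subgroup K P" "K \<subseteq> M" "point_stab \<Omega> M \<omega> \<subseteq> K" and "K \<noteq> M"
  shows "proper_partition \<Omega> (blocks K)"
proof -
  have "blocks K \<noteq> {\<Omega>}"
  proof
    assume "blocks K = {\<Omega>}"
    then have "block K \<one>\<^bsub>P\<^esub> = \<Omega>" unfolding blocks_def using subgroup.one_closed[OF subgroup_M] by blast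
    then have "y \<in> K" if "y \<in> M" for y
      using mem_block_iff[OF K subgroup.one_closed[OF subgroup_M] that] that M_carrier[OF that]
        apply_closed[OF _ base] by simp
    then show False using assms by blast
  qed
  then show ?thesis using partition_blocks[OF K] unfolding proper_partition_def by blast
qed

lemma image_block:
  assumes "g \<in> carrier P" "x \<in> carrier P" "K \<subseteq> carrier P"
  shows "g ` block K x = block K (g \<otimes>\<^bsub>P\<^esub> x)"
  unfolding block_def image_image
  by (rule image_cong) (use assms apply_closed base in \<open>auto simp: mult_apply subset_iff\<close>)

text \<open>\<open>m\<close> moves the block of the identity to the block of \<open>m\<close>, and
  these agree exactly when \<open>m \<in> K\<close>. So \<open>K\<close> is recovered from its coset
  partition.\<close>

lemma set_stab_block:
  assumes K: "subgroup K P" "K \<subseteq> M" "point_stab \<Omega> M \<omega> \<subseteq> K"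
  shows "set_stab \<Omega> M (block K \<one>\<^bsub>P\<^esub>) = K"
proof -
  have "m ` block K \<one>\<^bsub>P\<^esub> = block K \<one>\<^bsub>P\<^esub> \<longleftrightarrow> m \<in> K" if m: "m \<in> M" for m
  proof -
    have mc: "m \<in> carrier P" using m M_carrier by blast
    have img: "m ` block K \<one>\<^bsub>P\<^esub> = block K m"
      using image_block[OF mc one_closed] K(2) M_carrier mc by (simp add: subset_iff)
    have one: "\<one>\<^bsub>P\<^esub> \<in> M" using subgroup.one_closed[OF subgroup_M] .
    show ?thesis
      using img mem_block_iff[OF K one m] block_eqI[OF K one m] self_mem_block[OF K(1) mc] mc by auto
  qed
  then show ?thesis using K(2) by (auto simp: mem_set_stab_iff)
qed

lemma block_of_base:
  assumes K: "subgroup K P" "K \<subseteq> M" "point_stab \<Omega> M \<omega> \<subseteq> K"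
    and \<gamma>: "\<gamma> \<in> blocks K" "\<omega> \<in> \<gamma>"
  shows "\<gamma> = block K \<one>\<^bsub>P\<^esub>"
proof -
  have one: "\<one>\<^bsub>P\<^esub> \<in> M" using subgroup.one_closed[OF subgroup_M] .
  obtain x where x: "x \<in> M" "\<gamma> = block K x" using \<gamma> unfolding blocks_def by blast
  have "inv\<^bsub>P\<^esub> x \<otimes>\<^bsub>P\<^esub> \<one>\<^bsub>P\<^esub> \<in> K"
    using mem_block_iff[OF K x(1) one] x \<gamma> one_apply[OF base] by simp
  then show ?thesis using block_eqI[OF K x(1) one] x by simp
qed

section \<open>Action of group elements on coset partitions\<close>

lemma move_blocks_M:
  assumes "m \<in> M" "K \<subseteq> M"
  shows "move_partition m (blocks K) = blocks K"
proof -
  have "move_partition m (blocks K) = (\<lambda>x. block K (m \<otimes>\<^bsub>P\<^esub> x)) ` M"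
    unfolding move_partition_def blocks_def image_image
    by (rule image_cong) (use assms image_block M_carrier in \<open>auto simp: subset_iff\<close>)
  also have "\<dots> = block K ` ((\<lambda>x. m \<otimes>\<^bsub>P\<^esub> x) ` M)" by (simp add: image_image)
  also have "(\<lambda>x. m \<otimes>\<^bsub>P\<^esub> x) ` M = M"
  proof
    show "M \<subseteq> (\<lambda>x. m \<otimes>\<^bsub>P\<^esub> x) ` M"
    proof
      fix y assume y: "y \<in> M"
      then have "y = m \<otimes>\<^bsub>P\<^esub> (inv\<^bsub>P\<^esub> m \<otimes>\<^bsub>P\<^esub> y)"
        using M_carrier assms by (simp add: m_assoc[symmetric])
      then show "y \<in> (\<lambda>x. m \<otimes>\<^bsub>P\<^esub> x) ` M" using M_mult M_inv assms y by blast
    qed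
  qed (use assms M_mult in blast)
  finally show ?thesis unfolding blocks_def .
qed

text \<open>Since \<open>s\<close> fixes \<open>\<omega>\<close>, applying \<open>s\<close> to
  \<open>x (h \<omega>)\<close> amounts to replacing \<open>x\<close> and \<open>h\<close> by their
  conjugates under \<open>s\<close>; the conjugates of \<open>x\<close> again run through
  \<open>M\<close>.\<close>

lemma move_blocks_stab:
  assumes s: "s \<in> carrier P" "s \<omega> = \<omega>" and norm: "conj_set P s M = M" and K: "K \<subseteq> M"
  shows "move_partition s (blocks K) = blocks (conj_set P s K)"
proof -
  have img: "s ` block K x = block (conj_set P s K) (s \<otimes>\<^bsub>P\<^esub> x \<otimes>\<^bsub>P\<^esub> inv\<^bsub>P\<^esub> s)" if x: "x \<in> M" for x
    unfolding block_def conj_set_eq_image image_image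
  proof (rule image_cong[OF refl])
    fix h assume "h \<in> K"
    then have hc: "h \<in> carrier P" using K M_carrier by blast
    have xc: "x \<in> carrier P" using x M_carrier by blast
    have "(inv\<^bsub>P\<^esub> s) \<omega> = \<omega>" using inv_apply[OF s(1) base] s(2) by simp
    then show "s (x (h \<omega>)) = (s \<otimes>\<^bsub>P\<^esub> x \<otimes>\<^bsub>P\<^esub> inv\<^bsub>P\<^esub> s) ((s \<otimes>\<^bsub>P\<^esub> h \<otimes>\<^bsub>P\<^esub> inv\<^bsub>P\<^esub> s) \<omega>)"
      using s hc xc base apply_closed by (simp add: mult_apply inv_apply)
  qed
  have "move_partition s (blocks K) =
      (\<lambda>x. block (conj_set P s K) (s \<otimes>\<^bsub>P\<^esub> x \<otimes>\<^bsub>P\<^esub> inv\<^bsub>P\<^esub> s)) ` M"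
    unfolding move_partition_def blocks_def image_image by (rule image_cong[OF refl img])
  also have "\<dots> = block (conj_set P s K) ` conj_set P s M"
    unfolding conj_set_eq_image by (simp only: image_image)
  finally show ?thesis unfolding norm blocks_def .
qed

text \<open>Containment in \<open>\<Omega>\<close> matters because products in
  \<open>BijGroup \<Omega>\<close> are compositions only on \<open>\<Omega>\<close>.\<close>

lemma move_partition_mult:
  assumes "g \<in> carrier P" "h \<in> carrier P" "\<Union> \<Gamma> \<subseteq> \<Omega>"
  shows "move_partition (g \<otimes>\<^bsub>P\<^esub> h) \<Gamma> = move_partition g (move_partition h \<Gamma>)"
  unfolding move_partition_def image_image
proof (rule image_cong[OF refl], rule image_cong[OF refl])
  fix \<gamma> z assume "\<gamma> \<in> \<Gamma>" "z \<in> \<gamma>"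
  then show "(g \<otimes>\<^bsub>P\<^esub> h) z = g (h z)" using assms by (auto simp: mult_apply)
qed

text \<open>
  The condition \<open>K\<^sub>i (\<Inter>\<^sub>j\<^sub>\<noteq>\<^sub>i K\<^sub>j) = M\<close> on the family of subgroups appears here as a Chinese remainder
  condition.
\<close>

lemma cartesian_decomposition_blocks:
  assumes V: "finite V" "V \<noteq> {}"
    and K: "\<And>v. v \<in> V \<Longrightarrow> subgroup (K v) P" "\<And>v. v \<in> V \<Longrightarrow> K v \<subseteq> M" "\<And>v. v \<in> V \<Longrightarrow> K v \<noteq> M"
    and inter: "(\<Inter>v\<in>V. K v) = point_stab \<Omega> M \<omega>"
    and common: "\<And>x. (\<And>v. v \<in> V \<Longrightarrow> x v \<in> M) \<Longrightarrow> \<exists>y\<in>M. \<forall>v\<in>V. inv\<^bsub>P\<^esub> (x v) \<otimes>\<^bsub>P\<^esub> y \<in> K v"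
  shows "cartesian_decomposition \<Omega> ((\<lambda>v. blocks (K v)) ` V)"
  unfolding cartesian_decomposition_def
proof (intro conjI ballI)
  have W: "point_stab \<Omega> M \<omega> \<subseteq> K v" if "v \<in> V" for v using inter that by blast
  show "finite ((\<lambda>v. blocks (K v)) ` V)" "(\<lambda>v. blocks (K v)) ` V \<noteq> {}" using V by auto
  show "proper_partition \<Omega> \<Gamma>" if "\<Gamma> \<in> (\<lambda>v. blocks (K v)) ` V" for \<Gamma>
    using that proper_partition_blocks K W by auto
  fix \<gamma> assume \<gamma>: "\<gamma> \<in> (\<Pi> \<Gamma>\<in>(\<lambda>v. blocks (K v)) ` V. \<Gamma>)"
  have "\<exists>x\<in>M. \<gamma> (blocks (K v)) = block (K v) x" if v: "v \<in> V" for v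
  proof -
    have "\<gamma> (blocks (K v)) \<in> blocks (K v)" using \<gamma> v by (auto simp: Pi_iff)
    then show ?thesis unfolding blocks_def by blast
  qed
  then obtain x where x: "\<And>v. v \<in> V \<Longrightarrow> x v \<in> M" "\<And>v. v \<in> V \<Longrightarrow> \<gamma> (blocks (K v)) = block (K v) (x v)"
    by metis
  \<comment> \<open>One element \<open>y\<close> represents all the chosen blocks, so the blocks
    meet in \<open>y \<omega>\<close> at least.\<close>
  obtain y where y: "y \<in> M" "\<And>v. v \<in> V \<Longrightarrow> inv\<^bsub>P\<^esub> (x v) \<otimes>\<^bsub>P\<^esub> y \<in> K v" using common x(1) by metis
  have same: "\<gamma> (blocks (K v)) = block (K v) y" if v: "v \<in> V" for v
    using block_eqI[OF K(1,2)[OF v] W[OF v] x(1)[OF v] y(1) y(2)[OF v]] x(2)[OF v] by simp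
  have "(\<Inter>\<Gamma>\<in>(\<lambda>v. blocks (K v)) ` V. \<gamma> \<Gamma>) = (\<Inter>v\<in>V. block (K v) y)" using same by simp
  also have "\<dots> = {y \<omega>}"
  proof
    show "{y \<omega>} \<subseteq> (\<Inter>v\<in>V. block (K v) y)"
      using self_mem_block[OF K(1) M_carrier[OF y(1)]] by blast
    show "(\<Inter>v\<in>V. block (K v) y) \<subseteq> {y \<omega>}"
    proof
      fix u assume u: "u \<in> (\<Inter>v\<in>V. block (K v) y)"
      obtain v where v: "v \<in> V" using V by blast
      then have "u \<in> \<Omega>" using u block_sub[OF M_carrier[OF y(1)], of "K v"] K(2)[OF v] M_carrier by blast
      then obtain z where z: "z \<in> M" "u = z \<omega>" using trans by metis
      \<comment> \<open>Lying in every \<open>K v\<close> means lying in the point stabiliser, so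
        \<open>y\<close> and \<open>z\<close> agree at \<open>\<omega>\<close>.\<close>
      have "inv\<^bsub>P\<^esub> y \<otimes>\<^bsub>P\<^esub> z \<in> K v" if v: "v \<in> V" for v
        using u z mem_block_iff[OF K(1,2)[OF v] W[OF v] y(1) z(1)] v by simp
      then have "(inv\<^bsub>P\<^esub> y \<otimes>\<^bsub>P\<^esub> z) \<omega> = \<omega>" using inter by (auto simp: mem_point_stab_iff)
      then have "(inv\<^bsub>P\<^esub> y) (z \<omega>) = \<omega>" using y z M_carrier base by (simp add: mult_apply)
      then have "z \<omega> = y \<omega>"
        using inv_apply[of "inv\<^bsub>P\<^esub> y" "z \<omega>"] apply_closed base z y M_carrier by simp
      then show "u \<in> {y \<omega>}" using z by simp
    qed
  qed
  finally show "card (\<Inter>\<Gamma>\<in>(\<lambda>v. blocks (K v)) ` V. \<gamma> \<Gamma>) = 1" by simp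
qed

text \<open>In each partition the block through \<open>\<omega>\<close> is that of the identity,
  with stabiliser \<open>K v\<close>.\<close>

lemma CD_subgroups_blocks:
  assumes K: "\<And>v. v \<in> V \<Longrightarrow> subgroup (K v) P" "\<And>v. v \<in> V \<Longrightarrow> K v \<subseteq> M"
    "\<And>v. v \<in> V \<Longrightarrow> point_stab \<Omega> M \<omega> \<subseteq> K v"
  shows "CD_subgroups \<Omega> M \<omega> ((\<lambda>v. blocks (K v)) ` V) = K ` V"
proof
  show "CD_subgroups \<Omega> M \<omega> ((\<lambda>v. blocks (K v)) ` V) \<subseteq> K ` V"
  proof
    fix L assume "L \<in> CD_subgroups \<Omega> M \<omega> ((\<lambda>v. blocks (K v)) ` V)"
    then obtain v \<gamma> where v: "v \<in> V" "L = set_stab \<Omega> M \<gamma>" "\<gamma> \<in> blocks (K v)" "\<omega> \<in> \<gamma>"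
      unfolding CD_subgroups_def by blast
    then have "L = K v" using block_of_base[OF K[OF v(1)]] set_stab_block[OF K[OF v(1)]] by simp
    then show "L \<in> K ` V" using v by blast
  qed
  show "K ` V \<subseteq> CD_subgroups \<Omega> M \<omega> ((\<lambda>v. blocks (K v)) ` V)"
  proof
    fix L assume "L \<in> K ` V"
    then obtain v where v: "v \<in> V" "L = K v" by blast
    have "block (K v) \<one>\<^bsub>P\<^esub> \<in> blocks (K v)"
      unfolding blocks_def using subgroup.one_closed[OF subgroup_M] by blast
    moreover have "\<omega> \<in> block (K v) \<one>\<^bsub>P\<^esub>"
      using self_mem_block[OF K(1)[OF v(1)] one_closed] one_apply[OF base] by simp
    ultimately show "L \<in> CD_subgroups \<Omega> M \<omega> ((\<lambda>v. blocks (K v)) ` V)"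
      unfolding CD_subgroups_def using v set_stab_block[OF K[OF v(1)]] by blast
  qed
qed

end

subsection \<open>The converse construction\<close>

theorem mainTheorem4:
  fixes \<Omega> :: "'a set" and G M :: "('a \<Rightarrow> 'a) set" and \<omega> :: 'a
    and k :: nat and T :: "nat \<Rightarrow> ('a \<Rightarrow> 'a) set"
    and A B :: "('a \<Rightarrow> 'a) set"
    and \<Gamma> :: "('v, ('a \<Rightarrow> 'a) set) gen_graph"
    and \<phi> :: "('a \<Rightarrow> 'a) \<Rightarrow> 'v \<Rightarrow> 'v" and v\<^sub>1 v\<^sub>2 :: 'v
  assumes "innately_transitive \<Omega> G" and "finite G"
    and "plinth \<Omega> G M" and "\<not> comm_group (perm_group \<Omega> M)"
    and "simple_direct_factors (perm_group \<Omega> M) k T"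
    and "\<omega> \<in> \<Omega>"
    and "internal_direct_product (perm_group \<Omega> (point_stab \<Omega> M \<omega>)) {1..k}
           (\<lambda>i. dproj (perm_group \<Omega> M) {1..k} T i ` point_stab \<Omega> M \<omega>)"
    and "subgroup A (perm_group \<Omega> (T 1))" and "subgroup B (perm_group \<Omega> (T 1))"
    and "perm_group \<Omega> A \<cong> perm_group \<Omega> B" and "A \<noteq> T 1" and "B \<noteq> T 1"
    and "\<exists>g \<in> point_stab \<Omega> G \<omega>. conj_set (BijGroup \<Omega>) g A = B"
    and "A <#>\<^bsub>BijGroup \<Omega>\<^esub> B = T 1"
    and "A \<inter> B = dproj (perm_group \<Omega> M) {1..k} T 1 ` point_stab \<Omega> M \<omega>"
    and "point_stab \<Omega> G \<omega> \<inter> normalizer (BijGroup \<Omega>) (T 1) =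
           {g \<in> point_stab \<Omega> G \<omega>. conj_set (BijGroup \<Omega>) g ` {A, B} = {A, B}}"
    and "generalised_graph \<Gamma>" and "edges \<Gamma> = T ` {1..k}"
    and "transitive_action (perm_group \<Omega> (point_stab \<Omega> G \<omega>)) (verts \<Gamma>) \<phi>"
    and "transitive_action (perm_group \<Omega> (point_stab \<Omega> G \<omega>)) (edges \<Gamma>)
           (\<lambda>g. \<lambda>t\<in>edges \<Gamma>. conj_set (BijGroup \<Omega>) g t)"
    and "\<forall>g \<in> point_stab \<Omega> G \<omega>.
           (\<phi> g, \<lambda>t\<in>edges \<Gamma>. conj_set (BijGroup \<Omega>) g t) \<in> gen_graph_aut \<Gamma>"
    and "ends \<Gamma> (T 1) = {v\<^sub>1, v\<^sub>2}"
    and "\<forall>g \<in> point_stab \<Omega> G \<omega> \<inter> normalizer (BijGroup \<Omega>) (T 1).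
           (conj_set (BijGroup \<Omega>) g A, conj_set (BijGroup \<Omega>) g B) = (A, B) \<longleftrightarrow>
           (\<phi> g v\<^sub>1, \<phi> g v\<^sub>2) = (v\<^sub>1, v\<^sub>2)"
  shows "\<exists>\<E>. \<E> \<in> CD_2sim \<Omega> G M k T \<omega> \<and>
           gen_graph_isomorphic \<Gamma> (CD_graph \<Omega> M k T \<omega> \<E>) \<and>
           CD_factors \<Omega> M k T \<omega> \<E> 1 = {A, B}"
proof -

  \<comment> \<open>Translation of the hypotheses into the abstract setting\<close>
  let ?P = "BijGroup \<Omega>"
  define S W V where "S = point_stab \<Omega> G \<omega>" and "W = point_stab \<Omega> M \<omega>" and "V = verts \<Gamma>"
  note hyps = assms[folded S_def W_def V_def]
  interpret P: group ?P by (rule group_BijGroup)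
  have G: "subgroup G ?P" using hyps(1) unfolding innately_transitive_def by blast
  have M_normal: "M \<lhd> perm_group \<Omega> G" and M_one: "M \<noteq> {\<one>\<^bsub>?P\<^esub>}"
    and M_trans: "transitive_action (perm_group \<Omega> M) \<Omega> (\<lambda>g. g)"
    using hyps(3) unfolding plinth_def minimal_normal_def by auto
  have M: "subgroup M ?P" by (rule P.incl_subgroup[OF G normal_imp_subgroup[OF M_normal]])
  have M_sub_G: "M \<subseteq> G" using subgroup.subset[OF normal_imp_subgroup[OF M_normal]] by simp
  have conj_M: "g \<otimes>\<^bsub>?P\<^esub> x \<otimes>\<^bsub>?P\<^esub> inv\<^bsub>?P\<^esub> g \<in> M" if "g \<in> G" "x \<in> M" for g x
    using normal.inv_op_closed2[OF M_normal, of g x] that P.m_inv_consistent[OF G] by simp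
  interpret perm: transitive_perm_group \<Omega> M \<omega>
    using M hyps(6) transitive_action.unique_orbit[OF M_trans hyps(6)]
    by (intro transitive_perm_group.intro) auto
  have stab: "subgroup (stabilizer ?P (\<lambda>g. g) \<omega>) ?P"
    by (rule perm.act.stabilizer_subgroup[OF hyps(6)])
  have S_eq: "S = G \<inter> stabilizer ?P (\<lambda>g. g) \<omega>" and W_eq: "W = M \<inter> stabilizer ?P (\<lambda>g. g) \<omega>"
    unfolding S_def W_def point_stab_def stabilizer_def
    using subgroup.subset[OF G] subgroup.subset[OF M] by auto
  have S: "subgroup S ?P" and W: "subgroup W ?P"
    unfolding S_eq W_eq using P.subgroups_Inter_pair G M stab by auto
  have S_sub_G: "S \<subseteq> G" unfolding S_eq by blast
  have S_fix: "g \<omega> = \<omega>" if "g \<in> S" for g using that unfolding S_def mem_point_stab_iff by blast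
  have conj_W: "g \<otimes>\<^bsub>?P\<^esub> x \<otimes>\<^bsub>?P\<^esub> inv\<^bsub>?P\<^esub> g \<in> W" if "g \<in> S" "x \<in> W" for g x
  proof -
    have "g \<otimes>\<^bsub>?P\<^esub> x \<otimes>\<^bsub>?P\<^esub> inv\<^bsub>?P\<^esub> g \<in> stabilizer ?P (\<lambda>g. g) \<omega>"
      using that stab unfolding S_eq W_eq by (simp add: subgroup.m_closed subgroup.m_inv_closed)
    then show ?thesis using conj_M[of g x] that unfolding S_eq W_eq by blast
  qed
  have direct: "internal_direct_product (perm_group \<Omega> M) {1..k} T"
    and simple: "\<And>i. i \<in> {1..k} \<Longrightarrow> simple_group ((perm_group \<Omega> M)\<lparr>carrier := T i\<rparr>)"
    using hyps(5) unfolding simple_direct_factors_def by auto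
  interpret M: group "perm_group \<Omega> M" by (rule subgroup.subgroup_is_group[OF M P.is_group])
  \<comment> \<open>An empty family of factors would generate the trivial group, whereas the plinth
    is nontrivial.\<close>
  have one_mem: "1 \<in> {1..k}"
  proof (rule ccontr)
    assume "1 \<notin> {1..k}"
    then have "{1..k} = {}" by auto
    then have "generate (perm_group \<Omega> M) {} = M"
      using direct unfolding internal_direct_product_def by auto
    then show False using M.generate_empty M_one by simp
  qed
  have T_sub: "subgroup (T i) ?P" if "i \<in> {1..k}" for i
    using direct that P.incl_subgroup[OF M normal_imp_subgroup]
    unfolding internal_direct_product_def by blast
  have A: "subgroup A ?P" and B: "subgroup B ?P" and A_sub: "A \<subseteq> T 1" and B_sub: "B \<subseteq> T 1"
    using P.incl_subgroup[OF T_sub[OF one_mem]] hyps(8,9) subgroup.subset by fastforce+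
  \<comment> \<open>The decomposition of the point stabiliser as the product of its projections
    enters through the containment of these projections in it.\<close>
  have proj_W: "dproj (perm_group \<Omega> M) {1..k} T i ` W \<subseteq> W" if "i \<in> {1..k}" for i
  proof -
    have "dproj (perm_group \<Omega> M) {1..k} T i ` W \<lhd> perm_group \<Omega> W"
      using hyps(7) that unfolding internal_direct_product_def by blast
    then show ?thesis using subgroup.subset[OF normal_imp_subgroup] by fastforce
  qed
  interpret vert: transitive_action "perm_group \<Omega> S" V \<phi> by (rule hyps(19))
  interpret edge: transitive_action "perm_group \<Omega> S" "edges \<Gamma>"
    "\<lambda>g. \<lambda>t\<in>edges \<Gamma>. conj_set ?P g t" by (rule hyps(20))
  have T_edge: "T i \<in> edges \<Gamma>" if "i \<in> {1..k}" for i using hyps(18) that by blast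
  \<comment> \<open>The edges are the factors, so closure of the edge set under the action says that
    conjugation permutes the factors.\<close>
  have conj_T: "\<exists>j\<in>{1..k}. conj_set ?P g (T i) = T j" if "g \<in> S" "i \<in> {1..k}" for g i
    using edge.element_image[of g "T i"] that T_edge[OF that(2)] hyps(18) by auto
  have T_trans: "\<exists>g\<in>S. conj_set ?P g (T 1) = T i" if "i \<in> {1..k}" for i
    using edge.unique_orbit[OF T_edge[OF one_mem] T_edge[OF that]] T_edge[OF one_mem] by auto
  have norm_iff: "g \<in> S \<inter> normalizer ?P (T 1) \<longleftrightarrow> g \<in> S \<and> conj_set ?P g (T 1) = T 1" for g
    using P.mem_normalizer_iff[OF subgroup.subset[OF T_sub[OF one_mem]]] subgroup.subset[OF S] by blast
  have ends_T: "ends \<Gamma> (conj_set ?P g (T i)) = \<phi> g ` ends \<Gamma> (T i)" if "g \<in> S" "i \<in> {1..k}" for g i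
    using hyps(21) that T_edge[OF that(2)] unfolding gen_graph_aut_def by auto
  have "\<exists>v w. {v\<^sub>1, v\<^sub>2} = {v, w} \<and> v \<in> V \<and> w \<in> V \<and> v \<noteq> w"
    using hyps(17) T_edge[OF one_mem] hyps(22) unfolding generalised_graph_def V_def by fastforce
  then have v: "v\<^sub>1 \<in> V" "v\<^sub>2 \<in> V" "v\<^sub>1 \<noteq> v\<^sub>2" by (auto simp: doubleton_eq_iff)
  interpret D: arc_transitive_data ?P M S W "{1..k}" T 1 A B \<phi> V "ends \<Gamma>" v\<^sub>1 v\<^sub>2
  proof (intro arc_transitive_data.intro arc_transitive_data_axioms.intro P.is_group)
    show "T i \<noteq> {\<one>\<^bsub>?P\<^esub>}" if "i \<in> {1..k}" for i
      using simple_group.simple_not_triv[OF simple[OF that]] by simp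
    show "conj_set ?P g (T 1) = T 1 \<longleftrightarrow> conj_set ?P g ` {A, B} = {A, B}" if "g \<in> S" for g
      using hyps(16) norm_iff[of g] that by blast
    show "\<phi> \<one>\<^bsub>?P\<^esub> v = v" if "v \<in> V" for v
      using vert.id_eq_one that by (simp add: fun_eq_iff restrict_def) metis
    show "\<phi> (g \<otimes>\<^bsub>?P\<^esub> h) v = \<phi> g (\<phi> h v)" if "g \<in> S" "h \<in> S" "v \<in> V" for g h v
      using vert.composition_rule[of v g h] that by simp
    show "\<phi> g v \<in> V" if "g \<in> S" "v \<in> V" for g v
      using vert.element_image[of g v] that by simp
    show "\<exists>g\<in>S. \<phi> g v = w" if "v \<in> V" "w \<in> V" for v w
      using vert.unique_orbit[OF that] by simp
    show "conj_set ?P g A = A \<and> conj_set ?P g B = B \<longleftrightarrow> \<phi> g v\<^sub>1 = v\<^sub>1 \<and> \<phi> g v\<^sub>2 = v\<^sub>2"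
      if "g \<in> S" "conj_set ?P g (T 1) = T 1" for g
      using hyps(23) norm_iff[of g] that by blast
    show "g \<otimes>\<^bsub>?P\<^esub> x \<otimes>\<^bsub>?P\<^esub> inv\<^bsub>?P\<^esub> g \<in> M" if "g \<in> S" "x \<in> M" for g x
      using conj_M that S_sub_G by blast
    show "W \<subseteq> M" unfolding W_eq by blast
  qed (fact M S W conj_W finite_atLeastAtMost one_mem direct proj_W conj_T T_trans A B A_sub B_sub
      hyps(11,13-15,22) ends_T v)+
  \<comment> \<open>The vertex set is a single orbit of the finite group \<open>S\<close>.\<close>
  have finite_V: "finite V"
  proof -
    have "V \<subseteq> (\<lambda>g. \<phi> g v\<^sub>1) ` S" using D.\<phi>_trans[OF v(1)] by blast
    moreover have "finite S" using hyps(2) S_sub_G finite_subset by blast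
    ultimately show ?thesis using finite_surj by blast
  qed
  have W_sub_K: "W \<subseteq> D.K v" if "v \<in> V" for v using D.Inter_K that by blast

  \<comment> \<open>The decomposition, its invariance and transitivity\<close>
  define \<E> where "\<E> = (\<lambda>v. perm.blocks (D.K v)) ` V"
  have cd: "cartesian_decomposition \<Omega> \<E>"
    unfolding \<E>_def
    by (rule perm.cartesian_decomposition_blocks)
      (use finite_V v D.subgroup_K D.K_sub_M D.K_neq_M D.Inter_K D.ex_common_coset_element W_def in auto)
  have move_S: "move_partition s (perm.blocks (D.K v)) = perm.blocks (D.K (\<phi> s v))"
    if "s \<in> S" "v \<in> V" for s v
    using perm.move_blocks_stab[OF _ _ D.conj_set_M D.K_sub_M, of s v] D.S_carrier S_fix D.K_conj that
    by simp
  \<comment> \<open>A Frattini argument: as \<open>M\<close> is transitive, \<open>g\<close> is a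
    product of some \<open>m \<in> M\<close> and some \<open>s \<in> S\<close>. Since
    \<open>m\<close> preserves every coset partition, \<open>g\<close> acts on all of them as the
    single element \<open>s\<close> does.\<close>
  have move: "\<exists>s\<in>S. \<forall>v\<in>V. move_partition g (perm.blocks (D.K v)) = perm.blocks (D.K (\<phi> s v))"
    if g: "g \<in> G" for g
  proof -
    have gc: "g \<in> carrier ?P" using g subgroup.subset[OF G] by blast
    obtain m where m: "m \<in> M" "m \<omega> = g \<omega>" using perm.trans perm.apply_closed[OF gc perm.base] by blast
    have mc: "m \<in> carrier ?P" using perm.M_carrier[OF m(1)] .
    let ?s = "inv\<^bsub>?P\<^esub> m \<otimes>\<^bsub>?P\<^esub> g"
    have sc: "?s \<in> carrier ?P" using mc gc by simp
    have "?s \<omega> = (inv\<^bsub>?P\<^esub> m) (m \<omega>)" using mc gc perm.base m(2) by (simp add: perm.mult_apply)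
    also have "\<dots> = \<omega>" using perm.inv_apply[OF mc perm.base] .
    finally have "?s \<in> S"
      unfolding S_def mem_point_stab_iff
      using g m(1) M_sub_G G by (simp add: subgroup.m_closed subgroup.m_inv_closed subset_iff)
    moreover have "move_partition g (perm.blocks (D.K v)) = perm.blocks (D.K (\<phi> ?s v))"
      if v: "v \<in> V" and s: "?s \<in> S" for v
    proof -
      have "g = m \<otimes>\<^bsub>?P\<^esub> ?s" using mc gc by (simp add: P.m_assoc[symmetric])
      moreover have "\<Union> (perm.blocks (D.K v)) \<subseteq> \<Omega>"
        using perm.partition_blocks[OF D.subgroup_K D.K_sub_M W_sub_K[OF v, unfolded W_def]]
        unfolding partition_on_def by blast
      ultimately have "move_partition g (perm.blocks (D.K v)) =
          move_partition m (move_partition ?s (perm.blocks (D.K v)))"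
        using perm.move_partition_mult[OF mc sc] by metis
      then show ?thesis using move_S[OF s v] perm.move_blocks_M[OF m(1) D.K_sub_M] by simp
    qed
    ultimately show ?thesis by blast
  qed
  have inv: "invariant_CD G \<E>"
    unfolding invariant_CD_def
  proof
    fix g assume "g \<in> G"
    then obtain s where s: "s \<in> S"
      "\<And>v. v \<in> V \<Longrightarrow> move_partition g (perm.blocks (D.K v)) = perm.blocks (D.K (\<phi> s v))"
      using move by blast
    have "\<phi> s ` V = V" using vert.surj_prop s(1) by simp
    then have "\<E> = (\<lambda>v. perm.blocks (D.K v)) ` \<phi> s ` V" unfolding \<E>_def by simp
    also have "\<dots> = (\<lambda>v. perm.blocks (D.K (\<phi> s v))) ` V" by (rule image_image)
    also have "\<dots> = move_partition g ` \<E>"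
      unfolding \<E>_def image_image by (rule image_cong[OF refl s(2)[symmetric]])
    finally show "move_partition g ` \<E> = \<E>" by simp
  qed
  have tr: "\<E> \<in> CD_tr \<Omega> G"
  proof -
    have "\<exists>g\<in>G. move_partition g \<Delta> = \<Delta>'" if \<Delta>: "\<Delta> \<in> \<E>" "\<Delta>' \<in> \<E>" for \<Delta> \<Delta>'
    proof -
      obtain v w where vw: "v \<in> V" "w \<in> V" "\<Delta> = perm.blocks (D.K v)" "\<Delta>' = perm.blocks (D.K w)"
        using \<Delta> unfolding \<E>_def by blast
      obtain s where "s \<in> S" "\<phi> s v = w" using D.\<phi>_trans vw by blast
      then show ?thesis using move_S vw S_sub_G by blast
    qed
    then show ?thesis unfolding CD_tr_def using cd inv by blast
  qed

  \<comment> \<open>Subgroups, factor sets and graph of the decomposition\<close>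
  have subs: "CD_subgroups \<Omega> M \<omega> \<E> = D.K ` V"
    unfolding \<E>_def
    by (rule perm.CD_subgroups_blocks) (use D.subgroup_K D.K_sub_M W_sub_K W_def in auto)
  have factors: "CD_factors \<Omega> M k T \<omega> \<E> i = {conj_set ?P g A, conj_set ?P g B}"
    if "g \<in> S" "i \<in> {1..k}" "conj_set ?P g (T 1) = T i" for g i
    unfolding CD_factors_def subs using D.proper_projections[OF that] .
  have sim: "\<E> \<in> CD_2sim \<Omega> G M k T \<omega>"
    unfolding CD_2sim_def
  proof (intro CollectI conjI ballI)
    fix i assume i: "i \<in> {1..k}"
    obtain g where g: "g \<in> S" "conj_set ?P g (T 1) = T i" using T_trans[OF i] by blast
    show "card (CD_factors \<Omega> M k T \<omega> \<E> i) = 2"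
      unfolding factors[OF g(1) i g(2)] using D.conj_A_neq_conj_B[OF g(1)] by simp
    fix C C' assume "C \<in> CD_factors \<Omega> M k T \<omega> \<E> i" "C' \<in> CD_factors \<Omega> M k T \<omega> \<E> i"
    then show "\<exists>g\<in>point_stab \<Omega> G \<omega>. conj_set ?P g C = C'"
      unfolding factors[OF g(1) i g(2)] using D.conj_A_conj[OF g(1)] S_def by blast
  qed (rule tr)
  have one_S: "\<one>\<^bsub>?P\<^esub> \<in> S" using subgroup.one_closed[OF S] .
  have first: "CD_factors \<Omega> M k T \<omega> \<E> 1 = {A, B}"
    using factors[OF one_S one_mem] P.conj_set_one subgroup.subset[OF T_sub[OF one_mem]]
      D.AB_carrier by simp
  let ?\<Delta> = "CD_graph \<Omega> M k T \<omega> \<E>"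
  have ends_\<Delta>: "ends ?\<Delta> (T i) = D.K ` ends \<Gamma> (T i)" if i: "i \<in> {1..k}" for i
  proof -
    \<comment> \<open>\<open>CD_graph\<close> quantifies over all indices naming the factor;
      distinct indices name distinct factors, so only \<open>i\<close> remains.\<close>
    have "(\<exists>j\<in>{1..k}. T i = T j \<and> D.\<pi> j ` L \<noteq> T j) \<longleftrightarrow> D.\<pi> i ` L \<noteq> T i" for L
      using D.T_inj[OF i] i by blast
    then have "ends ?\<Delta> (T i) = {L \<in> D.K ` V. D.\<pi> i ` L \<noteq> T i}"
      unfolding CD_graph_def subs gen_graph.select_convs by (simp only:)
    also have "\<dots> = D.K ` ends \<Gamma> (T i)"
      by (rule D.properly_projecting_subgroups[OF i])
    finally show ?thesis .
  qed
  have "generalised_graph ?\<Delta>"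
    unfolding generalised_graph_def
  proof (intro conjI ballI)
    show "verts ?\<Delta> \<noteq> {}" unfolding CD_graph_def subs using v by auto
    fix t assume "t \<in> edges ?\<Delta>"
    then obtain i where i: "i \<in> {1..k}" "t = T i" unfolding CD_graph_def by auto
    obtain g where g: "g \<in> S" "conj_set ?P g (T 1) = T i" using T_trans[OF i(1)] by blast
    have "ends ?\<Delta> t = {D.K (\<phi> g v\<^sub>1), D.K (\<phi> g v\<^sub>2)}"
      using ends_\<Delta>[OF i(1)] i(2) D.ends_factor[OF g] by simp
    \<comment> \<open>Injectivity of \<open>D.K\<close> keeps the two ends distinct, so no edge
      collapses to a loop.\<close>
    moreover have "D.K (\<phi> g v\<^sub>1) \<noteq> D.K (\<phi> g v\<^sub>2)"
      using inj_onD[OF D.K_inj] D.neighbours_neq[OF g(1)] D.\<phi>_closed[OF g(1)] v by blast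
    moreover have "D.K (\<phi> g v\<^sub>1) \<in> verts ?\<Delta>" "D.K (\<phi> g v\<^sub>2) \<in> verts ?\<Delta>"
      unfolding CD_graph_def subs using D.\<phi>_closed[OF g(1)] v by auto
    ultimately show "ends ?\<Delta> t \<in>
        {{v\<^sub>1, v\<^sub>2} | v\<^sub>1 v\<^sub>2. v\<^sub>1 \<in> verts ?\<Delta> \<and> v\<^sub>2 \<in> verts ?\<Delta> \<and> v\<^sub>1 \<noteq> v\<^sub>2}"
      by blast
  qed
  moreover have "bij_betw D.K (verts \<Gamma>) (verts ?\<Delta>)"
    using D.K_inj unfolding CD_graph_def subs V_def by (simp add: bij_betw_def)
  moreover have "bij_betw id (edges \<Gamma>) (edges ?\<Delta>)"
    unfolding CD_graph_def using hyps(18) by simp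
  moreover have "\<forall>e\<in>edges \<Gamma>. ends ?\<Delta> (id e) = D.K ` ends \<Gamma> e"
    using hyps(18) ends_\<Delta> by auto
  ultimately have "gen_graph_isomorphic \<Gamma> ?\<Delta>"
    unfolding gen_graph_isomorphic_def using hyps(17) by blast
  then show ?thesis using sim first by blast
qed

end
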